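(* Let $\Delta_b(d,n)$ denote the maximum diameter of the graph of a $d$-dimensional polytope with $n$ facets. If $n > d \geq 3$, then \[\Delta_b(d,n) \leq \left[\tfrac23\left(n-d+\tfrac32\right)\right]^{\log (d-1)}.\]
   Context: A polytope is the convex hull of a finite set of points (a bounded polyhedron); $d$ is the dimension of its affine span and $n$ is the number of its $(d-1)$-dimensional faces (facets). The diameter is the maximum over pairs of vertices of the edge-distance in the graph (1-skeleton) of the polytope. All logarithms are base $2$. *)

theory Defs
  imports "HOL-Analysis.Analysis" "HOL-Library.Extended_Nat" "HOL-Library.Extended_Real"
begin

definition polytope_vertices :: "'a::euclidean_space set \<Rightarrow> 'a set" where
  "polytope_vertices P = {v. v extreme_point_of P}"

definition polytope_edges :: "'a::euclidean_space set \<Rightarrow> ('a \<times> 'a) set" where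
  "polytope_edges P =
     {(u, v). u \<in> polytope_vertices P \<and> v \<in> polytope_vertices P \<and> closed_segment u v edge_of P}"

(* Length of a shortest walk; infinite if there is no walk from u to v. *)
definition graph_dist :: "('a \<times> 'a) set \<Rightarrow> 'a \<Rightarrow> 'a \<Rightarrow> enat" where
  "graph_dist E u v = (INF k \<in> {k. (u, v) \<in> E ^^ k}. enat k)"

definition polytope_diameter :: "'a::euclidean_space set \<Rightarrow> enat" where
  "polytope_diameter P =
     (SUP u \<in> polytope_vertices P. SUP v \<in> polytope_vertices P. graph_dist (polytope_edges P) u v)"

(* The type argument is the ambient space, which needs only have dimension at least d:
   the polytopes need not be full-dimensional. A finite supremum of a nonempty set of
   extended naturals is attained, so a finite value of Delta_b is a maximum whenever
   d-dimensional polytopes with n facets exist in the ambient space. The supremum is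
   taken in enat because a supremum of an unbounded set of type nat carries no
   information. *)
definition Delta_b :: "'a::euclidean_space itself \<Rightarrow> nat \<Rightarrow> nat \<Rightarrow> enat" where
  "Delta_b _ d n =
     (SUP P \<in> {P :: 'a set. polytope P \<and> aff_dim P = int d \<and> card {F. F facet_of P} = n}.
        polytope_diameter P)"

end

theory Submission
  imports Defs
begin

text \<open>The induction runs over a class of functions larger than the distances from a vertex: integer
  functions \<open>f\<close> on the vertices that change by at most 1 along edges. If \<open>m\<close> facets meet the
  vertices with \<open>f\<close> between two attained values, then these values differ by at most the bound for
  \<open>m\<close> facets. In dimension 3, every level strictly in between separates the graph and so has at
  least three vertices by Balinski's theorem, while a nonempty set of vertices that is met by
  \<open>m\<close> facets has at most \<open>2m - 4\<close> elements. In higher dimensions, if \<open>m < 2d\<close> then the two end vertices share a facet;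
  otherwise the shortest initial and final ranges that meet more than \<open>m/2\<close> facets each have a
  facet in common, as in the argument of Kalai and Kleitman.\<close>

section \<open>The graph of a polytope\<close>

text \<open>The constants come from dimension 3. If the two values differ by l > 0, the l - 1 inner
  levels have at least three vertices each and the two end levels at least one, so 3 (l - 1) + 2 <=
  2 m - 4. This says l <= 2/3 (m - 3 + 3/2), and the exponent log 2 (3 - 1) is 1. Euler's formula
  would bound only the number of all vertices; a bound for a subset by the facets that it meets
  needs a local count, made here with the lowest and highest vertices of facets. The exponent comes
  from the recursion bound (d - 1) (m - 1) + 2 bound d (m / 2) + 2 <= bound d m. Passing to a facet
  keeps m - d, so only the exponent drops; halving the base divides its power by d - 1, so the two
  halves cost at most the fraction 2 / (d - 1). Below m = 2 d there is nothing to halve: a single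
  vertex already lies in d > m / 2 facets.\<close>

lemma finite_polytope_vertices: "polytope P \<Longrightarrow> finite (polytope_vertices P)"
  unfolding polytope_vertices_def
  by (simp add: finite_polyhedron_extreme_points polytope_imp_polyhedron)

lemma polytope_vertices_subset: "polytope_vertices P \<subseteq> P"
  by (auto simp: polytope_vertices_def extreme_point_of_def)

lemma polytope_eq_convex_hull_vertices:
  "polytope P \<Longrightarrow> P = convex hull (polytope_vertices P)"
  unfolding polytope_vertices_def
  by (simp add: Krein_Milman_Minkowski polytope_imp_compact polytope_imp_convex)

lemma polytope_vertices_face:
  "F face_of P \<Longrightarrow> polytope_vertices F = polytope_vertices P \<inter> F"
  by (auto simp: polytope_vertices_def extreme_point_of_face)

lemma polytope_edges_face: "F face_of P \<Longrightarrow> polytope_edges F \<subseteq> polytope_edges P"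
  using face_of_trans[of _ F P] by (auto simp: polytope_edges_def edge_of_def polytope_vertices_face)

lemma polytope_vertices_nonempty: "polytope P \<Longrightarrow> P \<noteq> {} \<Longrightarrow> polytope_vertices P \<noteq> {}"
  by (metis convex_hull_empty polytope_eq_convex_hull_vertices)

lemma polytope_edges_sym: "(u, v) \<in> polytope_edges P \<Longrightarrow> (v, u) \<in> polytope_edges P"
  by (auto simp: polytope_edges_def closed_segment_commute)

lemma polytope_edges_irrefl: "(u, v) \<in> polytope_edges P \<Longrightarrow> u \<noteq> v"
  by (auto simp: polytope_edges_def edge_of_def)

lemma polytope_edges_vertices:
  "(u, v) \<in> polytope_edges P \<Longrightarrow> u \<in> polytope_vertices P \<and> v \<in> polytope_vertices P"
  by (auto simp: polytope_edges_def)

lemma polytope_inner_le_vertices: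
  assumes "polytope P" "\<And>w. w \<in> polytope_vertices P \<Longrightarrow> c \<bullet> w \<le> b" "x \<in> P"
  shows "c \<bullet> x \<le> b"
proof -
  have "convex hull (polytope_vertices P) \<subseteq> {x. c \<bullet> x \<le> b}"
    by (rule hull_minimal) (use assms convex_halfspace_le in auto)
  then show ?thesis using polytope_eq_convex_hull_vertices[OF assms(1)] assms(3) by blast
qed

lemma face_exposed:
  fixes P :: "'a::euclidean_space set"
  assumes "polytope P" "F face_of P"
  obtains a b where "\<And>x. x \<in> P \<Longrightarrow> a \<bullet> x \<le> b" "\<And>x. x \<in> F \<longleftrightarrow> x \<in> P \<and> a \<bullet> x = b"
proof -
  have "F exposed_face_of P"
    using assms by (simp add: exposed_face_of_polyhedron polytope_imp_polyhedron)
  then show ?thesis unfolding exposed_face_of_def using that by blast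
qed

lemma maximizing_face:
  assumes "polytope P" "v \<in> P" "\<And>w. w \<in> polytope_vertices P \<Longrightarrow> c \<bullet> w \<le> c \<bullet> v"
  shows "P \<inter> {x. c \<bullet> x = c \<bullet> v} face_of P"
  using polytope_inner_le_vertices[OF assms(1,3)] assms(1)
  by (intro face_of_Int_supporting_hyperplane_le polytope_imp_convex) auto

lemma vertex_exposed:
  assumes "polytope P" "v \<in> polytope_vertices P"
  obtains h where "\<And>w. w \<in> P \<Longrightarrow> w \<noteq> v \<Longrightarrow> h \<bullet> w < h \<bullet> v"
proof -
  have "{v} face_of P" using assms(2) by (simp add: polytope_vertices_def face_of_singleton)
  then obtain a b where "\<And>x. x \<in> P \<Longrightarrow> a \<bullet> x \<le> b" "\<And>x. x \<in> {v} \<longleftrightarrow> x \<in> P \<and> a \<bullet> x = b"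
    using face_exposed[OF assms(1)] by blast
  then have "\<And>w. w \<in> P \<Longrightarrow> w \<noteq> v \<Longrightarrow> a \<bullet> w < a \<bullet> v"
    by (metis insertCI order_less_le singletonD)
  then show ?thesis using that by blast
qed

text \<open>Pass to a facet through \<open>v\<close> repeatedly until dimension 1, where the face is
  a segment with \<open>v\<close> as an endpoint.\<close>

lemma exists_edge_at_vertex:
  assumes "polytope P" "v \<in> polytope_vertices P" "1 \<le> aff_dim P"
  shows "\<exists>w. (v, w) \<in> polytope_edges P"
  using assms
proof (induction "nat (aff_dim P)" arbitrary: P rule: less_induct)
  case less
  have vP: "{v} face_of P" "v \<in> P"
    using less.prems by (auto simp: polytope_vertices_def face_of_singleton extreme_point_of_def)
  show ?case
  proof (cases "aff_dim P = 1")
    case True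
    have "collinear P" using True by (simp add: collinear_aff_dim)
    then obtain a b where P: "P = closed_segment a b"
      using compact_convex_collinear_segment[of P] less.prems vP
        polytope_imp_compact polytope_imp_convex by blast
    have "a \<noteq> b" using P True by auto
    have ab: "polytope_vertices P = {a, b}"
      by (auto simp: polytope_vertices_def P extreme_point_of_segment)
    have "P edge_of P"
      by (simp add: edge_of_def True face_of_refl less.prems polytope_imp_convex)
    then have "(a, b) \<in> polytope_edges P" using ab P by (auto simp: polytope_edges_def)
    then show ?thesis using less.prems(2) ab polytope_edges_sym by (metis insertE singletonD)
  next
    case False
    have "{v} \<noteq> P" using less.prems by auto
    then obtain F where F: "F facet_of P" "{v} \<subseteq> F"
      using face_of_polyhedron_subset_facet vP less.prems polytope_imp_polyhedron
      by (metis insert_not_empty)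
    then have FP: "F face_of P" "aff_dim F = aff_dim P - 1" by (auto simp: facet_of_def)
    have "\<exists>w. (v, w) \<in> polytope_edges F"
    proof (rule less.hyps)
      show "nat (aff_dim F) < nat (aff_dim P)" "1 \<le> aff_dim F"
        using FP False less.prems by auto
      show "polytope F" using FP less.prems face_of_polytope_polytope by blast
      show "v \<in> polytope_vertices F" using F FP less.prems polytope_vertices_face by blast
    qed
    then show ?thesis using polytope_edges_face[OF FP(1)] by blast
  qed
qed

text \<open>The simplex method: if \<open>h\<close> is uniquely maximal at \<open>v\<close> and \<open>\<mu>\<close> is the best slope
  \<open>(c w - c v) / (h v - h w)\<close>, then \<open>c + \<mu> h\<close> is maximal on a face through \<open>v\<close> on which every
  other vertex has a larger value of \<open>c\<close> than \<open>v\<close>.\<close>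

lemma exists_improving_edge:
  assumes P: "polytope P" and v: "v \<in> polytope_vertices P" and p: "p \<in> P" "c \<bullet> v < c \<bullet> p"
  shows "\<exists>w. (v, w) \<in> polytope_edges P \<and> c \<bullet> v < c \<bullet> w"
proof -
  let ?V = "polytope_vertices P"
  obtain h where h: "\<And>w. w \<in> P \<Longrightarrow> w \<noteq> v \<Longrightarrow> h \<bullet> w < h \<bullet> v" using vertex_exposed[OF P v] by blast
  obtain w0 where w0: "w0 \<in> ?V" "c \<bullet> v < c \<bullet> w0"
    using polytope_inner_le_vertices[OF P _ p(1), of c "c \<bullet> v"] p(2) by fastforce
  have VP: "?V \<subseteq> P" by (rule polytope_vertices_subset)
  define r where "r w = (c \<bullet> w - c \<bullet> v) / (h \<bullet> v - h \<bullet> w)" for w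
  have fin: "finite (?V - {v})" "?V - {v} \<noteq> {}"
    using finite_polytope_vertices[OF P] w0 by auto
  define m where "m = Max (r ` (?V - {v}))"
  obtain w1 where w1: "w1 \<in> ?V" "w1 \<noteq> v" "r w1 = m"
  proof -
    have "m \<in> r ` (?V - {v})" unfolding m_def using fin by (intro Max_in) auto
    then show ?thesis using that by blast
  qed
  have rm: "r w \<le> m" if "w \<in> ?V" "w \<noteq> v" for w
    unfolding m_def using fin that by (intro Max_ge) auto
  have "w0 \<noteq> v" "w0 \<in> P" using w0 VP by auto
  then have "0 < r w0" unfolding r_def using w0 h[of w0] by simp
  \<comment> \<open>A positive \<open>m\<close> is what turns a drop of \<open>h\<close> along the
    edge found below into a rise of \<open>c\<close>.\<close>
  then have m0: "0 < m" using rm[of w0] w0(1) \<open>w0 \<noteq> v\<close> by linarith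
  define e where "e = c + m *\<^sub>R h"
  have le: "e \<bullet> w \<le> e \<bullet> v" if "w \<in> ?V" for w
  proof (cases "w = v")
    case False
    have "h \<bullet> w < h \<bullet> v" using h False that VP by auto
    then have "c \<bullet> w - c \<bullet> v \<le> m * (h \<bullet> v - h \<bullet> w)"
      using rm[OF that False] by (simp add: r_def pos_divide_le_eq)
    then show ?thesis by (simp add: e_def inner_add_left algebra_simps)
  qed simp
  have w1P: "w1 \<in> P" using VP w1 by blast
  then have "h \<bullet> w1 < h \<bullet> v" using h w1 by blast
  then have "c \<bullet> w1 - c \<bullet> v = m * (h \<bullet> v - h \<bullet> w1)"
    using w1(3) by (simp add: r_def divide_eq_eq)
  then have eq: "e \<bullet> w1 = e \<bullet> v" by (simp add: e_def inner_add_left algebra_simps)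
  define G where "G = P \<inter> {x. e \<bullet> x = e \<bullet> v}"
  have vP: "v \<in> P" using v VP by blast
  have GP: "G face_of P" unfolding G_def by (rule maximizing_face[OF P vP le])
  then have "polytope G" using P face_of_polytope_polytope by blast
  have vw: "v \<in> G" "w1 \<in> G" using vP w1P eq by (auto simp: G_def)
  have "aff_dim G \<noteq> 0" using vw w1 by (auto simp: aff_dim_eq_0)
  moreover have "0 \<le> aff_dim G" using vw by (metis aff_dim_negative_iff empty_iff not_le)
  ultimately have "1 \<le> aff_dim G" by linarith
  then obtain w where w: "(v, w) \<in> polytope_edges G"
    using exists_edge_at_vertex[OF \<open>polytope G\<close>] polytope_vertices_face[OF GP] v vw by blast
  then have "w \<noteq> v" "w \<in> G"
    using polytope_edges_irrefl[OF w] polytope_edges_vertices[OF w] polytope_vertices_subset[of G]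
    by auto
  then have "h \<bullet> w < h \<bullet> v" "e \<bullet> w = e \<bullet> v" using h by (auto simp: G_def)
  then have "c \<bullet> w - c \<bullet> v = m * (h \<bullet> v - h \<bullet> w)" by (simp add: e_def inner_add_left algebra_simps)
  moreover have "0 < m * (h \<bullet> v - h \<bullet> w)" using m0 \<open>h \<bullet> w < h \<bullet> v\<close> by simp
  ultimately have "c \<bullet> v < c \<bullet> w" by linarith
  then show ?thesis using w polytope_edges_face[OF GP] by blast
qed

text \<open>Improving edges are iterated; the number of strictly higher vertices decreases. The
  restricted relation records that the path never falls below its start, which later keeps it away
  from removed vertices.\<close>

lemma ascending_path:
  assumes P: "polytope P" and v: "v \<in> polytope_vertices P"
  shows "\<exists>w \<in> polytope_vertices P. (\<forall>x\<in>P. c \<bullet> x \<le> c \<bullet> w) \<and>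
    (v, w) \<in> (polytope_edges P \<inter> {x. c \<bullet> v \<le> c \<bullet> x} \<times> {x. c \<bullet> v \<le> c \<bullet> x})\<^sup>*"
  using v
proof (induction "card {w \<in> polytope_vertices P. c \<bullet> v < c \<bullet> w}" arbitrary: v rule: less_induct)
  case less
  show ?case
  proof (cases "\<forall>x\<in>P. c \<bullet> x \<le> c \<bullet> v")
    case True
    then show ?thesis using less.prems by blast
  next
    case False
    then obtain w where w: "(v, w) \<in> polytope_edges P" "c \<bullet> v < c \<bullet> w"
      using exists_improving_edge[OF P less.prems] by force
    then have wV: "w \<in> polytope_vertices P" using polytope_edges_vertices by blast
    have "card {x \<in> polytope_vertices P. c \<bullet> w < c \<bullet> x} < card {x \<in> polytope_vertices P. c \<bullet> v < c \<bullet> x}"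
      by (rule psubset_card_mono) (use finite_polytope_vertices[OF P] w wV in auto)
    from less.hyps[OF this wV] obtain t where t: "t \<in> polytope_vertices P" "\<forall>x\<in>P. c \<bullet> x \<le> c \<bullet> t"
      "(w, t) \<in> (polytope_edges P \<inter> {x. c \<bullet> w \<le> c \<bullet> x} \<times> {x. c \<bullet> w \<le> c \<bullet> x})\<^sup>*" by blast
    have "(w, t) \<in> (polytope_edges P \<inter> {x. c \<bullet> v \<le> c \<bullet> x} \<times> {x. c \<bullet> v \<le> c \<bullet> x})\<^sup>*"
      using t(3) by (rule rtrancl_mono[THEN subsetD, rotated]) (use w in auto)
    then have "(v, t) \<in> (polytope_edges P \<inter> {x. c \<bullet> v \<le> c \<bullet> x} \<times> {x. c \<bullet> v \<le> c \<bullet> x})\<^sup>*"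
      by (rule converse_rtrancl_into_rtrancl[rotated]) (use w in auto)
    then show ?thesis using t by blast
  qed
qed

text \<open>An ascending path for a functional whose only maximum on \<open>P\<close> is at
  \<open>v\<close> must end at \<open>v\<close>.\<close>

lemma polytope_graph_connected:
  assumes P: "polytope P" and v: "u \<in> polytope_vertices P" "v \<in> polytope_vertices P"
  shows "(u, v) \<in> (polytope_edges P)\<^sup>*"
proof -
  obtain h where h: "\<And>w. w \<in> P \<Longrightarrow> w \<noteq> v \<Longrightarrow> h \<bullet> w < h \<bullet> v" using vertex_exposed[OF P v(2)] by blast
  obtain w where w: "w \<in> polytope_vertices P" "\<forall>x\<in>P. h \<bullet> x \<le> h \<bullet> w" 
    "(u, w) \<in> (polytope_edges P \<inter> {x. h \<bullet> u \<le> h \<bullet> x} \<times> {x. h \<bullet> u \<le> h \<bullet> x})\<^sup>*"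
    using ascending_path[OF P v(1)] by blast
  have "w = v" using w h v(2) polytope_vertices_subset by (metis linorder_not_less subsetD)
  then show ?thesis using w(3) by (metis Int_lower1 rtrancl_mono subsetD)
qed

section \<open>Facets of facets and facets through a face\<close>

text \<open>\<open>R\<close> is the intersection of the facets of \<open>P\<close> that contain it,
  so one of them, \<open>G\<close>, does not contain \<open>F\<close>. Then
  \<open>F \<inter> G\<close> is a proper face of \<open>F\<close> containing \<open>R\<close>, and
  the dimensions leave no room between them.\<close>

lemma facet_of_facet:
  assumes P: "polytope P" and F: "F facet_of P" and R: "R facet_of F" 
  shows "\<exists>G. G facet_of P \<and> G \<noteq> F \<and> R = F \<inter> G"
proof -
  have FP: "F face_of P" "F \<noteq> P" using F by (auto simp: facet_of_def)
  have RP: "R face_of F" "R \<noteq> {}" "R \<noteq> F" "R \<subseteq> F" "aff_dim R = aff_dim F - 1"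
    using R facet_of_imp_subset[OF R] by (auto simp: facet_of_def)
  have RP': "R face_of P" "R \<noteq> P"
    using face_of_trans[OF RP(1) FP(1)] face_of_imp_subset[OF FP(1)] RP(4) FP(2) by auto
  have "R = \<Inter>{G. G facet_of P \<and> R \<subseteq> G}"
    by (rule face_of_polyhedron[OF polytope_imp_polyhedron[OF P] RP'(1) RP(2) RP'(2)])
  then obtain G where G: "G facet_of P" "R \<subseteq> G" "\<not> F \<subseteq> G" using RP by blast
  have "F \<inter> G face_of P" using FP G face_of_Int facet_of_imp_face_of by blast
  then have FG: "F \<inter> G face_of F" by (metis FP(1) face_of_face inf_le1)
  have cF: "convex F" using FP face_of_imp_convex by blast
  have "aff_dim (F \<inter> G) < aff_dim F" using FG cF G by (intro face_of_aff_dim_lt) auto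
  moreover have "R face_of F \<inter> G" using RP FG G by (metis Int_greatest face_of_face)
  moreover have "convex (F \<inter> G)" using FG face_of_imp_convex by blast
  ultimately have "R = F \<inter> G" using face_of_aff_dim_lt[of "F \<inter> G" R] RP(5) by fastforce
  then show ?thesis using G by blast
qed

definition facets_meeting :: "'a::euclidean_space set \<Rightarrow> 'a set \<Rightarrow> 'a set set" where
  "facets_meeting P W = {F. F facet_of P \<and> F \<inter> W \<noteq> {}}"

lemma finite_facets_meeting: "polytope P \<Longrightarrow> finite (facets_meeting P W)"
  unfolding facets_meeting_def by (rule finite_subset[OF _ finite_polytope_facets[of P]]) auto

text \<open>Writing each \<open>R\<close> as \<open>F \<inter> G\<close> gives an injection into the
  facets other than \<open>F\<close>; the summand 1 is \<open>F\<close> itself. \<open>T\<close> is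
  left abstract to serve both the facets through a fixed face and the facets meeting a range of
  levels.\<close>

lemma card_facet_facets:
  assumes P: "polytope P" and F: "F facet_of P"
    and R: "\<And>R. R \<in> \<R> \<Longrightarrow> R facet_of F"
    and T: "finite T" "F \<in> T" "\<And>R G. R \<in> \<R> \<Longrightarrow> G facet_of P \<Longrightarrow> R \<subseteq> G \<Longrightarrow> G \<in> T"
  shows "card \<R> + 1 \<le> card T"
proof -
  have "\<forall>R\<in>\<R>. \<exists>G. G facet_of P \<and> G \<noteq> F \<and> R = F \<inter> G" using facet_of_facet[OF P F] R by blast
  then obtain g where g: "\<And>R. R \<in> \<R> \<Longrightarrow> g R facet_of P \<and> g R \<noteq> F \<and> R = F \<inter> g R" by metis
  have "inj_on g \<R>"
  proof (rule inj_onI)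
    fix R R' assume "R \<in> \<R>" "R' \<in> \<R>" "g R = g R'"
    then show "R = R'" using g[of R] g[of R'] by simp
  qed
  moreover have "g ` \<R> \<subseteq> T - {F}"
  proof
    fix G assume "G \<in> g ` \<R>"
    then obtain R where R: "R \<in> \<R>" "G = g R" by blast
    then have "R \<subseteq> G" using g[of R] by auto
    then show "G \<in> T - {F}" using T(3)[OF R(1)] g[OF R(1)] R(2) by simp
  qed
  ultimately have "card \<R> \<le> card (T - {F})" using T(1) card_inj_on_le by blast
  moreover have "card T > 0" using T card_gt_0_iff by blast
  ultimately show ?thesis using T by simp
qed

text \<open>Induction on the codimension: each facet through \<open>C\<close> of a facet
  \<open>F\<close> gives a facet of \<open>P\<close> through \<open>C\<close>, and \<open>F\<close>
  is one more.\<close>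

lemma card_facets_containing_face:
  assumes "polytope P" "C face_of P" "C \<noteq> {}" "aff_dim P = aff_dim C + int k"
  shows "k \<le> card {F. F facet_of P \<and> C \<subseteq> F}"
  using assms
proof (induction k arbitrary: P)
  case (Suc k)
  have "C \<noteq> P" using Suc.prems by auto
  then obtain F where F: "F facet_of P" "C \<subseteq> F"
    using face_of_polyhedron_subset_facet Suc.prems polytope_imp_polyhedron by metis
  then have FP: "F face_of P" "aff_dim F = aff_dim P - 1" by (auto simp: facet_of_def)
  have pF: "polytope F" using FP Suc.prems face_of_polytope_polytope by blast
  have "k \<le> card {R. R facet_of F \<and> C \<subseteq> R}"
  proof (rule Suc.IH[OF pF _ Suc.prems(3)])
    show "C face_of F" using Suc.prems F FP by (simp add: face_of_face)
    show "aff_dim F = aff_dim C + int k" using FP Suc.prems by simp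
  qed
  moreover have "card {R. R facet_of F \<and> C \<subseteq> R} + 1 \<le> card {F. F facet_of P \<and> C \<subseteq> F}"
    by (rule card_facet_facets[OF Suc.prems(1) F(1)])
      (use F Suc.prems finite_polytope_facets[of P] in auto)
  ultimately show ?case by linarith
qed simp

lemma card_facets_at_vertex:
  assumes "polytope P" "v \<in> polytope_vertices P" "aff_dim P = int d"
  shows "d \<le> card {F. F facet_of P \<and> v \<in> F}"
  using card_facets_containing_face[of P "{v}" d] assms
  by (simp add: polytope_vertices_def face_of_singleton)

section \<open>Vertices and facets of 3-polytopes\<close>

text \<open>The relative interior is dense in \<open>F\<close>, so it has points strictly on both
  sides of the hyperplane, and it is connected.\<close>

lemma rel_interior_attains_between:
  fixes F :: "'a::euclidean_space set"
  assumes "convex F" "x \<in> F" "y \<in> F" "c \<bullet> x < b" "b < c \<bullet> y"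
  shows "\<exists>p \<in> rel_interior F. c \<bullet> p = b"
proof -
  have cl: "F \<subseteq> closure (rel_interior F)"
    using assms(1) by (simp add: convex_closure_rel_interior closure_subset)
  have "{z. c \<bullet> z < b} \<inter> rel_interior F \<noteq> {}"
    using cl assms open_Int_closure_eq_empty[OF open_halfspace_lt[of c b], of "rel_interior F"] by blast
  moreover have "{z. c \<bullet> z > b} \<inter> rel_interior F \<noteq> {}"
    using cl assms open_Int_closure_eq_empty[OF open_halfspace_gt[of b c], of "rel_interior F"] by blast
  ultimately obtain x' y' where "x' \<in> rel_interior F" "y' \<in> rel_interior F" "c \<bullet> x' < b" "b < c \<bullet> y'"
    by blast
  then show ?thesis
    using connected_ivt_hyperplane[of "rel_interior F" x' y' c b]
      convex_connected[OF convex_rel_interior[OF assms(1)]] by force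
qed

lemma linear_relation_of_three:
  fixes x y z :: "'a::euclidean_space"
  assumes V: "x \<in> V" "y \<in> V" "z \<in> V" "dim V < 3"
  shows "\<exists>a b e. (a \<noteq> 0 \<or> b \<noteq> 0 \<or> e \<noteq> 0) \<and> a *\<^sub>R x + b *\<^sub>R y + e *\<^sub>R z = 0"
proof (cases "x = y \<or> x = z \<or> y = z")
  case True
  then consider "x = y" | "x = z" | "y = z" by blast
  then show ?thesis
  proof cases
    case 1 show ?thesis by (rule exI[of _ 1], rule exI[of _ "-1"], rule exI[of _ 0]) (simp add: 1)
  next
    case 2 show ?thesis by (rule exI[of _ 1], rule exI[of _ 0], rule exI[of _ "-1"]) (simp add: 2)
  next
    case 3 show ?thesis by (rule exI[of _ 0], rule exI[of _ 1], rule exI[of _ "-1"]) (simp add: 3)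
  qed
next
  case False
  then have "card {x, y, z} = 3" by simp
  then have "dependent {x, y, z}"
    using V independent_card_le_dim[of "{x, y, z}" V] by auto
  then obtain u where u: "\<exists>v\<in>{x, y, z}. u v \<noteq> 0" "(\<Sum>v\<in>{x, y, z}. u v *\<^sub>R v) = 0"
    by (auto simp: dependent_finite)
  then have "u x *\<^sub>R x + u y *\<^sub>R y + u z *\<^sub>R z = 0" using False by (simp add: add.assoc)
  then show ?thesis using u(1) by blast
qed

text \<open>A functional exposing \<open>H\<close> vanishes on \<open>r - v\<close> but is negative
  on \<open>p - v\<close> and \<open>q - v\<close>, so nonnegative coefficients must be 0.\<close>

lemma facet_conic_combination:
  fixes P :: "'a::euclidean_space set"
  assumes P: "polytope P" and facets: "F facet_of P" "G facet_of P" "H facet_of P" "F \<noteq> H" "G \<noteq> H"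
    and pts: "v \<in> H" "r \<in> H" "p \<in> rel_interior F" "q \<in> rel_interior G"
    and comb: "a *\<^sub>R (p - v) + b *\<^sub>R (q - v) = e *\<^sub>R (r - v)" "0 \<le> a" "0 \<le> b"
  shows "a = 0 \<and> b = 0"
proof -
  have HP: "H face_of P" using facets facet_of_imp_face_of by blast
  obtain n m where n: "\<And>x. x \<in> P \<Longrightarrow> n \<bullet> x \<le> m" "\<And>x. x \<in> H \<longleftrightarrow> x \<in> P \<and> n \<bullet> x = m"
    using face_exposed[OF P HP] by blast
  \<comment> \<open>A relative interior point of \<open>K\<close> in the face \<open>H\<close> would
    force \<open>K \<subseteq> H\<close>, hence equality by dimension.\<close>
  have less: "n \<bullet> s < m" if K: "K facet_of P" "K \<noteq> H" "s \<in> rel_interior K" for K s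
  proof (rule ccontr)
    assume "\<not> n \<bullet> s < m"
    moreover have "s \<in> P" using K rel_interior_subset facet_of_imp_subset by blast
    ultimately have "s \<in> H" using n[of s] by force
    then have "K \<subseteq> H" using subset_of_face_of[OF HP facet_of_imp_subset[OF K(1)]] K by blast
    then have "K face_of H" using K HP by (simp add: face_of_face facet_of_imp_face_of)
    moreover have "aff_dim K = aff_dim H" using K facets by (auto simp: facet_of_def)
    ultimately show False
      using face_of_aff_dim_lt[OF face_of_imp_convex[OF HP]] K(2) by fastforce
  qed
  have "n \<bullet> (a *\<^sub>R (p - v) + b *\<^sub>R (q - v)) = 0"
    unfolding comb using pts n(2) by (simp add: inner_diff_right)
  then have "a * (n \<bullet> p - m) + b * (n \<bullet> q - m) = 0"
    using pts n(2) by (simp add: inner_diff_right inner_add_right)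
  moreover have "n \<bullet> p - m < 0" "n \<bullet> q - m < 0" using less facets pts by auto
  moreover have "a * (n \<bullet> p - m) \<le> 0" "b * (n \<bullet> q - m) \<le> 0"
    using comb \<open>n \<bullet> p - m < 0\<close> \<open>n \<bullet> q - m < 0\<close> by (auto intro: mult_nonneg_nonpos)
  ultimately have "a * (n \<bullet> p - m) = 0" "b * (n \<bullet> q - m) = 0" by linarith+
  then show ?thesis using \<open>n \<bullet> p - m < 0\<close> \<open>n \<bullet> q - m < 0\<close> by auto
qed

text \<open>Near a vertex \<open>v\<close> the section of a 3-polytope by a hyperplane through \<open>v\<close> is a planar
  cone, which only two facets can bound.\<close>

lemma card_facets_split_at_vertex:
  fixes P :: "'a::euclidean_space set"
  assumes P: "polytope P" "aff_dim P = 3"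
  shows "card {F. F facet_of P \<and> v \<in> F \<and> (\<exists>x\<in>F. c \<bullet> x < c \<bullet> v) \<and> (\<exists>x\<in>F. c \<bullet> v < c \<bullet> x)} \<le> 2"
    (is "card ?S \<le> 2")
proof (rule ccontr)
  assume "\<not> card ?S \<le> 2"
  then have "3 \<le> card ?S" by simp
  then obtain T where T: "T \<subseteq> ?S" "card T = 3" by (rule obtain_subset_with_card_n)
  obtain F G H where T3: "T = {F, G, H}" "F \<noteq> G" "F \<noteq> H" "G \<noteq> H"
    using T(2) unfolding card_3_iff by blast
  have FGH: "F \<in> ?S" "G \<in> ?S" "H \<in> ?S" "F \<noteq> G" "F \<noteq> H" "G \<noteq> H"
    using T(1) T3(2-4) unfolding T3(1) insert_subset by - (elim conjE, assumption)+
  have level: "\<exists>p\<in>rel_interior K. c \<bullet> p = c \<bullet> v" if "K \<in> ?S" for K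
  proof -
    have "convex K" using that facet_of_imp_face_of face_of_imp_convex by blast
    then show ?thesis using that rel_interior_attains_between[of K] by blast
  qed
  obtain p q r where pqr: "p \<in> rel_interior F" "q \<in> rel_interior G" "r \<in> rel_interior H"
    "c \<bullet> p = c \<bullet> v" "c \<bullet> q = c \<bullet> v" "c \<bullet> r = c \<bullet> v"
    using level FGH(1-3) by meson
  have in_facet: "p \<in> F" "q \<in> G" "r \<in> H" using pqr rel_interior_subset by blast+
  have vP: "v \<in> P" using FGH(1) facet_of_imp_subset by blast
  define D where "D = (\<lambda>x. x - v) ` P"
  have "aff_dim P = int (dim D)"
    unfolding D_def by (rule aff_dim_eq_dim_subtract) (simp add: vP hull_inc)
  then have D3: "dim D = 3" using P by simp
  \<comment> \<open>The directions of the section: at most two-dimensional because \<open>c\<close>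
    is not constant on \<open>P\<close>, so three vectors in it are dependent.\<close>
  define V where "V = {u \<in> span D. c \<bullet> u = 0}"
  have sub: "subspace V"
    unfolding V_def by (auto simp: subspace_def span_zero span_add span_scale inner_add_right)
  obtain x where x: "x \<in> F" "c \<bullet> x < c \<bullet> v" using FGH(1) by blast
  then have "x - v \<in> span D" using FGH(1) facet_of_imp_subset D_def by (auto intro!: span_base)
  moreover have "x - v \<notin> V" using x by (simp add: V_def inner_diff_right)
  ultimately have "V \<subset> span D" by (auto simp: V_def)
  then have "span V \<subset> span D" using sub by (simp add: span_eq_iff[THEN iffD2])
  then have dV: "dim V < 3" using dim_psubset D3 by metis
  have "F \<subseteq> P" "G \<subseteq> P" "H \<subseteq> P" using FGH(1-3) facet_of_imp_subset by blast+
  then have "p - v \<in> V" "q - v \<in> V" "r - v \<in> V"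
    using pqr(4-6) in_facet by (auto simp: V_def D_def inner_diff_right intro!: span_base)
  then obtain a b e where abe: "a \<noteq> 0 \<or> b \<noteq> 0 \<or> e \<noteq> 0"
    "a *\<^sub>R (p - v) + b *\<^sub>R (q - v) + e *\<^sub>R (r - v) = 0"
    using linear_relation_of_three[OF _ _ _ dV] by meson
  have pair: "s = 0 \<and> t = 0"
    if K: "K \<in> ?S" "L \<in> ?S" "M \<in> ?S" "K \<noteq> M" "L \<noteq> M"
      "k \<in> rel_interior K" "l \<in> rel_interior L" "m \<in> rel_interior M"
      and rel: "s *\<^sub>R (k - v) + t *\<^sub>R (l - v) + w *\<^sub>R (m - v) = 0" and st: "0 \<le> s * t"
    for K L M k l m s t w
  proof -
    have M: "v \<in> M" "m \<in> M" using K rel_interior_subset by blast+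
    have "s *\<^sub>R (k - v) + t *\<^sub>R (l - v) = (- w) *\<^sub>R (m - v)"
      using rel by (simp add: eq_neg_iff_add_eq_0)
    moreover have "(- s) *\<^sub>R (k - v) + (- t) *\<^sub>R (l - v) = w *\<^sub>R (m - v)"
      using rel by (simp add: algebra_simps neg_eq_iff_add_eq_0 add_eq_0_iff)
    moreover have "0 \<le> s \<and> 0 \<le> t \<or> 0 \<le> - s \<and> 0 \<le> - t"
      using st by (auto simp: zero_le_mult_iff)
    ultimately show ?thesis
      using facet_conic_combination[OF P(1), of K L M v m k l] K M
      by (smt (verit, best) mem_Collect_eq)
  qed
  have ab: "a = 0 \<and> b = 0" if "0 \<le> a * b"
    using pair[OF FGH(1,2,3,5,6) pqr(1,2,3) abe(2) that] .
  have ae: "a = 0 \<and> e = 0" if "0 \<le> a * e"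
    by (rule pair[OF FGH(1,3,2,4) _ pqr(1,3,2) _ that, of b]) (use FGH(6) abe(2) in \<open>auto simp: ac_simps\<close>)
  have be: "b = 0 \<and> e = 0" if "0 \<le> b * e"
    by (rule pair[OF FGH(2,3,1) _ _ pqr(2,3,1) _ that, of a]) (use FGH(4,5) abe(2) in \<open>auto simp: ac_simps\<close>)
  \<comment> \<open>Three reals cannot have pairwise opposite signs. Once two coefficients vanish,
    their products with the third are 0, so the third vanishes as well.\<close>
  consider "0 \<le> a * b" | "0 \<le> a * e" | "0 \<le> b * e" 
    by (metis linorder_not_le mult_less_0_iff order_less_asym)
  then show False
    using ab ae be abe(1) by cases auto
qed

section \<open>Generic linear functionals\<close>

lemma eventually_affine_nonzero:
  assumes "p \<noteq> 0 \<or> q \<noteq> (0::real)"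
  shows "eventually (\<lambda>e. p + e * q \<noteq> 0) (at_right 0)"
proof (cases "p = 0")
  case True
  then show ?thesis using assms by (auto simp: eventually_at_filter)
next
  case False
  have "((\<lambda>e. p + e * q) \<longlongrightarrow> p + 0 * q) (at_right 0)" by (intro tendsto_intros)
  then show ?thesis using False by (intro tendsto_imp_eventually_ne[of _ p]) auto
qed

text \<open>To include a further vector \<open>d\<close>, add a small positive multiple of
  \<open>d\<close> to \<open>g\<close>: nonzero products stay nonzero, and the one with
  \<open>d\<close> becomes nonzero because \<open>d \<bullet> d\<close> is.\<close>

lemma exists_nonorthogonal:
  fixes D :: "'a::real_inner set"
  assumes "finite D" "0 \<notin> D"
  shows "\<exists>g. \<forall>d\<in>D. g \<bullet> d \<noteq> 0"
  using assms
proof (induction D)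
  case (insert d D)
  then obtain g where g: "\<forall>d\<in>D. g \<bullet> d \<noteq> 0" by auto
  have "\<forall>x\<in>insert d D. eventually (\<lambda>e. g \<bullet> x + e * (d \<bullet> x) \<noteq> 0) (at_right 0)"
    using g insert.prems by (intro ballI eventually_affine_nonzero) auto
  then have "eventually (\<lambda>e. \<forall>x\<in>insert d D. g \<bullet> x + e * (d \<bullet> x) \<noteq> 0) (at_right 0)"
    by (intro eventually_ball_finite) (use insert.hyps in auto)
  then obtain e where "\<forall>x\<in>insert d D. g \<bullet> x + e * (d \<bullet> x) \<noteq> 0"
    using eventually_happens'[OF trivial_limit_at_right_real] by blast
  then show ?case by (intro exI[of _ "g + e *\<^sub>R d"]) (simp add: inner_add_left)
qed simp

text \<open>Perturb \<open>h\<close> by a small multiple of a functional that is nonzero on all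
  differences of distinct points; the strict maximum at \<open>t\<close> survives.\<close>

lemma generic_functional:
  fixes V :: "'a::real_inner set"
  assumes "finite V" "\<And>w. w \<in> V \<Longrightarrow> w \<noteq> t \<Longrightarrow> h \<bullet> w < h \<bullet> t"
  obtains c where "inj_on (\<lambda>w. c \<bullet> w) V" "\<And>w. w \<in> V \<Longrightarrow> c \<bullet> w \<le> c \<bullet> t"
proof -
  define D where "D = {x - y | x y. x \<in> V \<and> y \<in> V \<and> x \<noteq> y}"
  have "D \<subseteq> (\<lambda>(x, y). x - y) ` (V \<times> V)" unfolding D_def by auto
  then have fD: "finite D" using assms(1) by (meson finite_SigmaI finite_imageI finite_subset)
  moreover have "0 \<notin> D" by (auto simp: D_def)
  ultimately obtain g where g: "\<forall>d\<in>D. g \<bullet> d \<noteq> 0" using exists_nonorthogonal by blast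
  have "eventually (\<lambda>e. \<forall>x\<in>D. h \<bullet> x + e * (g \<bullet> x) \<noteq> 0) (at_right 0)"
    using g fD by (intro eventually_ball_finite ballI eventually_affine_nonzero) auto
  moreover have "eventually (\<lambda>e. \<forall>w\<in>V. h \<bullet> w + e * (g \<bullet> w) \<le> h \<bullet> t + e * (g \<bullet> t)) (at_right 0)"
  proof (intro eventually_ball_finite ballI)
    fix w assume w: "w \<in> V"
    show "eventually (\<lambda>e. h \<bullet> w + e * (g \<bullet> w) \<le> h \<bullet> t + e * (g \<bullet> t)) (at_right 0)"
    proof (cases "w = t")
      case False
      have "((\<lambda>e. (h \<bullet> t + e * (g \<bullet> t)) - (h \<bullet> w + e * (g \<bullet> w)))
        \<longlongrightarrow> (h \<bullet> t + 0 * (g \<bullet> t)) - (h \<bullet> w + 0 * (g \<bullet> w))) (at_right 0)"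
        by (intro tendsto_intros)
      then have "eventually (\<lambda>e. 0 < (h \<bullet> t + e * (g \<bullet> t)) - (h \<bullet> w + e * (g \<bullet> w))) (at_right 0)"
        by (rule order_tendstoD) (use assms(2)[OF w False] in simp)
      then show ?thesis by (rule eventually_mono) simp
    qed simp
  qed (use assms in auto)
  ultimately have "eventually (\<lambda>e. (\<forall>x\<in>D. h \<bullet> x + e * (g \<bullet> x) \<noteq> 0) \<and>
      (\<forall>w\<in>V. h \<bullet> w + e * (g \<bullet> w) \<le> h \<bullet> t + e * (g \<bullet> t))) (at_right 0)"
    by (rule eventually_conj)
  then obtain e where e: "\<forall>x\<in>D. h \<bullet> x + e * (g \<bullet> x) \<noteq> 0"
    "\<forall>w\<in>V. h \<bullet> w + e * (g \<bullet> w) \<le> h \<bullet> t + e * (g \<bullet> t)"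
    using eventually_happens'[OF trivial_limit_at_right_real] by blast
  have "inj_on (\<lambda>w. (h + e *\<^sub>R g) \<bullet> w) V"
  proof (rule inj_onI, rule ccontr)
    fix x y assume xy: "x \<in> V" "y \<in> V" "(h + e *\<^sub>R g) \<bullet> x = (h + e *\<^sub>R g) \<bullet> y" "x \<noteq> y"
    then have "x - y \<in> D" by (auto simp: D_def)
    then have "h \<bullet> (x - y) + e * (g \<bullet> (x - y)) \<noteq> 0" using e by blast
    then show False using xy(3) by (simp add: inner_add_left inner_diff_right algebra_simps)
  qed
  then show ?thesis using that[of "h + e *\<^sub>R g"] e(2) by (simp add: inner_add_left)
qed

lemma polytope_max_vertex:
  assumes "polytope P" "P \<noteq> {}"
  shows "\<exists>w \<in> polytope_vertices P. \<forall>x\<in>P. c \<bullet> x \<le> c \<bullet> w"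
  using ascending_path[OF assms(1)] polytope_vertices_nonempty[OF assms] by blast

lemma facet_polytope: "polytope P \<Longrightarrow> F facet_of P \<Longrightarrow> polytope F"
  using facet_of_imp_face_of face_of_polytope_polytope by blast

text \<open>For a functional that is injective on the vertices, every facet has one lowest and one highest
  vertex. Every vertex is lowest or highest in some facet, because at most two of the at least three
  facets through it are split by its level set. The summand 4 comes from the top of \<open>W\<close>,
  which is chosen to be the top of \<open>P\<close>, and from the bottom of \<open>W\<close>: either it is the bottom of \<open>P\<close>,
  or a descending edge from it lies in two facets with lowest vertex outside \<open>W\<close>.\<close>

lemma card_vertices_le_facets_meeting:
  fixes P :: "'a::euclidean_space set"
  assumes P: "polytope P" "aff_dim P = 3" and W: "W \<subseteq> polytope_vertices P" "W \<noteq> {}"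
  shows "card W + 4 \<le> 2 * card (facets_meeting P W)"
proof -
  define T where "T = facets_meeting P W"
  have finT: "finite T" unfolding T_def using finite_facets_meeting P by blast
  have finV: "finite (polytope_vertices P)" using finite_polytope_vertices P by blast
  then have finW: "finite W" using W finite_subset by blast
  have VP: "polytope_vertices P \<subseteq> P" by (rule polytope_vertices_subset)
  obtain t where t: "t \<in> W" using W by blast
  then have tV: "t \<in> polytope_vertices P" using W by blast
  obtain h where h: "\<And>w. w \<in> P \<Longrightarrow> w \<noteq> t \<Longrightarrow> h \<bullet> w < h \<bullet> t" using vertex_exposed[OF P(1) tV] by blast
  obtain c where c: "inj_on (\<lambda>w. c \<bullet> w) (polytope_vertices P)"
    "\<And>w. w \<in> polytope_vertices P \<Longrightarrow> c \<bullet> w \<le> c \<bullet> t"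
    using generic_functional[OF finV, of t h] h VP by (metis subsetD)
  have c_top: "c \<bullet> x \<le> c \<bullet> t" if "x \<in> P" for x
    by (rule polytope_inner_le_vertices[OF P(1) c(2) that])
  have facet_T: "F facet_of P" if "F \<in> T" for F using that by (simp add: T_def facets_meeting_def)
  have extremes: "\<exists>l u. l \<in> polytope_vertices F \<and> u \<in> polytope_vertices F \<and>
      (\<forall>x\<in>F. c \<bullet> l \<le> c \<bullet> x \<and> c \<bullet> x \<le> c \<bullet> u)" if F: "F \<in> T" for F
  proof -
    have "polytope F" "F \<noteq> {}" using facet_polytope[OF P(1)] facet_T[OF F] by (auto simp: facet_of_def)
    from polytope_max_vertex[OF this, of c] polytope_max_vertex[OF this, of "- c"]
    show ?thesis by (auto simp: inner_minus_left)
  qed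
  then obtain lo hi where lohi: "\<And>F. F \<in> T \<Longrightarrow> lo F \<in> polytope_vertices F \<and> hi F \<in> polytope_vertices F \<and>
      (\<forall>x\<in>F. c \<bullet> lo F \<le> c \<bullet> x \<and> c \<bullet> x \<le> c \<bullet> hi F)"
    by metis
  have VF: "polytope_vertices F \<subseteq> polytope_vertices P" "polytope_vertices F \<subseteq> F" if "F \<in> T" for F
    using polytope_vertices_face[OF facet_of_imp_face_of[OF facet_T[OF that]]] by auto
  define X where "X w = {F. F facet_of P \<and> w \<in> F}" for w
  have X: "X w \<subseteq> T" "3 \<le> card (X w)" "finite (X w)" if "w \<in> W" for w
  proof -
    show "X w \<subseteq> T" using that by (auto simp: X_def T_def facets_meeting_def)
    then show "finite (X w)" using finT finite_subset by blast
    show "3 \<le> card (X w)"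
      using card_facets_at_vertex[of P w 3] P W that by (auto simp: X_def)
  qed
  define L where "L w = {F \<in> T. lo F = w}" for w
  define U where "U w = {F \<in> T. hi F = w}" for w
  have finLU: "finite (L w)" "finite (U w)" for w using finT by (auto simp: L_def U_def)
  have inL: "F \<in> L w" if "w \<in> W" "F \<in> X w" "\<forall>x\<in>F. c \<bullet> w \<le> c \<bullet> x" for w F
  proof -
    have FT: "F \<in> T" using X that by blast
    have wF: "w \<in> F" "lo F \<in> F" "lo F \<in> polytope_vertices P" "w \<in> polytope_vertices P"
      using that lohi[OF FT] VF[OF FT] W(1) by (auto simp: X_def)
    have "c \<bullet> lo F = c \<bullet> w" using lohi[OF FT] that(3) wF(1,2) by (auto intro: antisym)
    then have "lo F = w" using inj_onD[OF c(1) _ wF(3,4)] by blast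
    then show ?thesis using FT by (simp add: L_def)
  qed
  have inU: "F \<in> U w" if "w \<in> W" "F \<in> X w" "\<forall>x\<in>F. c \<bullet> x \<le> c \<bullet> w" for w F
  proof -
    have FT: "F \<in> T" using X that by blast
    have wF: "w \<in> F" "hi F \<in> F" "hi F \<in> polytope_vertices P" "w \<in> polytope_vertices P"
      using that lohi[OF FT] VF[OF FT] W(1) by (auto simp: X_def)
    have "c \<bullet> hi F = c \<bullet> w" using lohi[OF FT] that(3) wF(1,2) by (auto intro: antisym)
    then have "hi F = w" using inj_onD[OF c(1) _ wF(3,4)] by blast
    then show ?thesis using FT by (simp add: U_def)
  qed
  define N where "N w = card (L w) + card (U w)" for w
  have N1: "1 \<le> N w" if w: "w \<in> W" for w
  proof -
    let ?S = "{F. F facet_of P \<and> w \<in> F \<and> (\<exists>x\<in>F. c \<bullet> x < c \<bullet> w) \<and> (\<exists>x\<in>F. c \<bullet> w < c \<bullet> x)}"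
    have S: "?S \<subseteq> X w" by (auto simp: X_def)
    have "X w \<subseteq> L w \<union> U w \<union> ?S"
    proof
      fix F assume F: "F \<in> X w"
      have "F \<in> L w \<or> (\<exists>x\<in>F. c \<bullet> x < c \<bullet> w)" "F \<in> U w \<or> (\<exists>x\<in>F. c \<bullet> w < c \<bullet> x)"
        using inL[OF w F] inU[OF w F] by (meson not_le)+
      then show "F \<in> L w \<union> U w \<union> ?S" using F by (auto simp: X_def)
    qed
    then have "card (X w) \<le> card (L w \<union> U w \<union> ?S)"
      by (rule card_mono[rotated]) (use finLU S X(3)[OF w] finite_subset in blast)
    also have "\<dots> \<le> card (L w) + card (U w) + card ?S"
      by (meson add_le_mono card_Un_le le_refl order_trans)
    finally show ?thesis
      using X(2)[OF w] card_facets_split_at_vertex[OF P, of w c] by (simp add: N_def)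
  qed
  have Nt: "3 \<le> N t"
  proof -
    have "X t \<subseteq> U t" using inU[OF t] c_top by (auto simp: X_def dest: facet_of_imp_subset)
    then have "card (X t) \<le> card (U t)" using card_mono[OF finLU(2)] by blast
    then show ?thesis using X(2)[OF t] by (simp add: N_def)
  qed
  \<comment> \<open>Double counting: each facet in \<open>T\<close> has one highest and one lowest
    vertex, so it contributes at most 2 to the sum of \<open>N\<close>.\<close>
  have cardU: "(\<Sum>w\<in>W. card (U w)) = card {F \<in> T. hi F \<in> W}"
  proof -
    have "{F \<in> T. hi F \<in> W} = (\<Union>w\<in>W. U w)" by (auto simp: U_def)
    then show ?thesis using finW finLU(2) by (auto simp: U_def intro!: card_UN_disjoint[symmetric])
  qed
  have cardL: "(\<Sum>w\<in>W. card (L w)) = card {F \<in> T. lo F \<in> W}"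
  proof -
    have "{F \<in> T. lo F \<in> W} = (\<Union>w\<in>W. L w)" by (auto simp: L_def)
    then show ?thesis using finW finLU(1) by (auto simp: L_def intro!: card_UN_disjoint[symmetric])
  qed
  have "card {F \<in> T. hi F \<in> W} \<le> card T" using finT by (intro card_mono) auto
  then have sumN: "(\<Sum>w\<in>W. N w) \<le> card {F \<in> T. lo F \<in> W} + card T"
    unfolding N_def sum.distrib cardU cardL by linarith
  obtain b where b: "b \<in> W" "\<And>w. w \<in> W \<Longrightarrow> c \<bullet> b \<le> c \<bullet> w"
    using finW W(2) arg_min_if_finite[of W "\<lambda>w. c \<bullet> w"] by (metis not_le)
  have bP: "b \<in> polytope_vertices P" "b \<in> P" using b W VP by blast+
  \<comment> \<open>If \<open>b\<close> is the bottom of \<open>P\<close>, the sum of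
    \<open>N\<close> is at least 3 + 3 + (|W| - 2) and at most 2 |T|. Otherwise it is at least 3 +
    (|W| - 1), but two facets have their lowest vertex outside \<open>W\<close>, so it is at most 2
    |T| - 2.\<close>
  show ?thesis
  proof (cases "\<forall>x\<in>P. c \<bullet> b \<le> c \<bullet> x")
    case True
    have "X b \<subseteq> L b" using inL[OF b(1)] True by (auto simp: X_def dest: facet_of_imp_subset)
    then have "card (X b) \<le> card (L b)" using card_mono[OF finLU(1)] by blast
    then have Nb: "3 \<le> N b" using X(2)[OF b(1)] by (simp add: N_def)
    have "b \<noteq> t"
    proof
      assume "b = t"
      have "polytope_vertices P \<subseteq> {t}"
      proof
        fix w assume w: "w \<in> polytope_vertices P"
        then have "c \<bullet> t \<le> c \<bullet> w" using True VP \<open>b = t\<close> by blast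
        then have "c \<bullet> w = c \<bullet> t" using c(2)[OF w] by linarith
        then show "w \<in> {t}" using inj_onD[OF c(1) _ w tV] by blast
      qed
      then have "P \<subseteq> {t}"
        by (subst polytope_eq_convex_hull_vertices[OF P(1)]) (metis convex_hull_singleton hull_mono)
      then have "aff_dim P \<le> aff_dim {t}" by (rule aff_dim_subset)
      then show False using P by simp
    qed
    have "(\<Sum>w\<in>W. N w) = N t + N b + (\<Sum>w\<in>W - {t, b}. N w)"
    proof -
      have "b \<in> W - {t}" "W - {t} - {b} = W - {t, b}" using b \<open>b \<noteq> t\<close> by auto
      then show ?thesis
        using sum.remove[OF finW t, of N] sum.remove[of "W - {t}" b N] finW by simp
    qed
    moreover have "(\<Sum>w\<in>W - {t, b}. N w) \<ge> (\<Sum>w\<in>W - {t, b}. 1)"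
      by (rule sum_mono) (use N1 in auto)
    moreover have "card (W - {t, b}) + 2 = card W"
    proof -
      have "card {t, b} = 2" "{t, b} \<subseteq> W" using \<open>b \<noteq> t\<close> t b by auto
      then show ?thesis using card_mono[OF finW, of "{t, b}"] by (simp add: card_Diff_subset)
    qed
    moreover have "card {F \<in> T. lo F \<in> W} \<le> card T" using finT by (intro card_mono) auto
    ultimately show ?thesis using Nt Nb sumN unfolding T_def by simp
  next
    case False
    then obtain x where "x \<in> P" "(- c) \<bullet> b < (- c) \<bullet> x" by (auto simp: not_le)
    from exists_improving_edge[OF P(1) bP(1) this]
    obtain w where w: "(b, w) \<in> polytope_edges P" "c \<bullet> w < c \<bullet> b" by auto
    define e where "e = closed_segment b w"
    have e: "e face_of P" "aff_dim e = 1" "e \<noteq> {}" "b \<in> e" "w \<in> e"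
      using w(1) by (auto simp: polytope_edges_def edge_of_def e_def)
    have "2 \<le> card {F. F facet_of P \<and> e \<subseteq> F}"
      using card_facets_containing_face[OF P(1) e(1,3), of 2] P e by simp
    moreover have "{F. F facet_of P \<and> e \<subseteq> F} \<subseteq> T - {F \<in> T. lo F \<in> W}"
    proof
      fix F assume "F \<in> {F. F facet_of P \<and> e \<subseteq> F}"
      then have F: "F facet_of P" "b \<in> F" "w \<in> F" using e by auto
      then have FT: "F \<in> T" using b by (auto simp: T_def facets_meeting_def)
      then have "c \<bullet> lo F \<le> c \<bullet> w" using lohi F by blast
      then have "lo F \<notin> W" using w b(2) by force
      then show "F \<in> T - {F \<in> T. lo F \<in> W}" using FT by blast
    qed
    ultimately have "2 \<le> card (T - {F \<in> T. lo F \<in> W})"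
      using finT by (meson card_mono finite_Diff order_trans)
    moreover have "card (T - {F \<in> T. lo F \<in> W}) + card {F \<in> T. lo F \<in> W} = card T"
      using card_mono[OF finT, of "{F \<in> T. lo F \<in> W}"] finT by (subst card_Diff_subset) auto
    moreover have "(\<Sum>w\<in>W. N w) = N t + (\<Sum>w\<in>W - {t}. N w)"
      using finW t by (simp add: sum.remove)
    moreover have "(\<Sum>w\<in>W - {t}. N w) \<ge> (\<Sum>w\<in>W - {t}. 1)"
      by (rule sum_mono) (use N1 in auto)
    moreover have "card (W - {t}) + 1 = card W"
      using finW t by (metis Suc_eq_plus1 card_Suc_Diff1)
    ultimately show ?thesis using Nt sumN unfolding T_def by simp
  qed
qed

section \<open>Separating vertex sets of 3-polytopes\<close>

lemma sym_Restr_edges: "sym ((Restr (polytope_edges P) A)\<^sup>*)"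
  by (intro sym_rtrancl symI) (auto intro: polytope_edges_sym)

text \<open>Both vertices climb to the face where \<open>c\<close> is maximal, whose graph is
  connected and lies strictly above level \<open>b\<close>, hence off \<open>S\<close>. From a
  vertex on the hyperplane the first improving edge, which exists because of \<open>p\<close>,
  already leaves it.\<close>

lemma upper_vertices_connected:
  fixes P :: "'a::euclidean_space set"
  assumes P: "polytope P" and p: "p \<in> P" "b < c \<bullet> p" and S: "\<And>s. s \<in> S \<Longrightarrow> c \<bullet> s = b"
    and u: "u \<in> polytope_vertices P" "u \<notin> S" "b \<le> c \<bullet> u"
    and v: "v \<in> polytope_vertices P" "v \<notin> S" "b \<le> c \<bullet> v"
  shows "(u, v) \<in> (Restr (polytope_edges P) (- S))\<^sup>*"
proof -
  let ?R = "Restr (polytope_edges P) (- S)"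
  have to_top: "\<exists>t\<in>polytope_vertices P. (\<forall>x\<in>P. c \<bullet> x \<le> c \<bullet> t) \<and> (w, t) \<in> ?R\<^sup>*"
    if w: "w \<in> polytope_vertices P" "b < c \<bullet> w" for w
  proof -
    obtain t where t: "t \<in> polytope_vertices P" "\<forall>x\<in>P. c \<bullet> x \<le> c \<bullet> t"
      "(w, t) \<in> (Restr (polytope_edges P) {x. c \<bullet> w \<le> c \<bullet> x})\<^sup>*"
      using ascending_path[OF P w(1), of c] by blast
    have "Restr (polytope_edges P) {x. c \<bullet> w \<le> c \<bullet> x} \<subseteq> ?R" using S w(2) by force
    then show ?thesis using t rtrancl_mono by blast
  qed
  have reach: "\<exists>t\<in>polytope_vertices P. (\<forall>x\<in>P. c \<bullet> x \<le> c \<bullet> t) \<and> (w, t) \<in> ?R\<^sup>*"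
    if w: "w \<in> polytope_vertices P" "w \<notin> S" "b \<le> c \<bullet> w" for w
  proof (cases "b < c \<bullet> w")
    case False
    then have "c \<bullet> w < c \<bullet> p" using w p by linarith
    then obtain y where y: "(w, y) \<in> polytope_edges P" "c \<bullet> w < c \<bullet> y"
      using exists_improving_edge[OF P w(1) p(1)] by blast
    then have "y \<in> polytope_vertices P" "b < c \<bullet> y" "y \<notin> S"
      using polytope_edges_vertices[OF y(1)] w S by force+
    then obtain t where "t \<in> polytope_vertices P" "\<forall>x\<in>P. c \<bullet> x \<le> c \<bullet> t" "(y, t) \<in> ?R\<^sup>*"
      using to_top by blast
    moreover have "(w, y) \<in> ?R" using y w \<open>y \<notin> S\<close> by blast
    ultimately show ?thesis by (meson converse_rtrancl_into_rtrancl)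
  qed (use to_top w in blast)
  obtain t where t: "t \<in> polytope_vertices P" "\<forall>x\<in>P. c \<bullet> x \<le> c \<bullet> t" "(u, t) \<in> ?R\<^sup>*"
    using reach[OF u] by blast
  obtain t' where t': "t' \<in> polytope_vertices P" "\<forall>x\<in>P. c \<bullet> x \<le> c \<bullet> t'" "(v, t') \<in> ?R\<^sup>*"
    using reach[OF v] by blast
  have tP: "t \<in> P" "t' \<in> P" using t t' polytope_vertices_subset by blast+
  define G where "G = P \<inter> {x. c \<bullet> x = c \<bullet> t}"
  have G: "G face_of P"
    unfolding G_def by (rule maximizing_face[OF P tP(1)]) (use t polytope_vertices_subset in blast)
  have "c \<bullet> t = c \<bullet> t'" using t t' tP by (meson order_antisym)
  then have "t \<in> polytope_vertices G" "t' \<in> polytope_vertices G"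
    unfolding polytope_vertices_face[OF G] using t t' tP by (auto simp: G_def)
  then have "(t, t') \<in> (polytope_edges G)\<^sup>*"
    using polytope_graph_connected[OF face_of_polytope_polytope[OF P G]] by blast
  moreover have "polytope_edges G \<subseteq> ?R"
  proof (rule subrelI)
    fix x y assume xy: "(x, y) \<in> polytope_edges G"
    then have "x \<in> G" "y \<in> G" using polytope_edges_vertices[OF xy] polytope_vertices_subset by blast+
    moreover have "b < c \<bullet> t" using t(2) p by force
    ultimately have "x \<notin> S" "y \<notin> S" using S by (auto simp: G_def)
    then show "(x, y) \<in> ?R" using xy polytope_edges_face[OF G] by blast
  qed
  ultimately have "(t, t') \<in> ?R\<^sup>*" using rtrancl_mono by blast
  moreover have "(t', v) \<in> ?R\<^sup>*" using t'(3) sym_Restr_edges by (rule symD[rotated])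
  ultimately show ?thesis using t(3) by (meson rtrancl_trans)
qed

text \<open>Balinski's theorem for 3-polytopes: the two removed vertices and \<open>u\<close> lie in a common
  hyperplane, and the vertices on either closed side of it stay connected.\<close>

lemma connected_after_removing_two:
  fixes P :: "'a::euclidean_space set"
  assumes P: "polytope P" "aff_dim P = 3" and S: "S \<subseteq> P" "finite S" "card S \<le> 2"
    and u: "u \<in> polytope_vertices P" "u \<notin> S" and v: "v \<in> polytope_vertices P" "v \<notin> S"
  shows "(u, v) \<in> (Restr (polytope_edges P) (- S))\<^sup>*"
proof -
  have uP: "u \<in> P" using u polytope_vertices_subset by blast
  define D where "D = (\<lambda>x. x - u) ` P"
  define D' where "D' = (\<lambda>x. x - u) ` S"
  have "aff_dim P = int (dim D)"
    unfolding D_def by (rule aff_dim_eq_dim_subtract) (simp add: uP hull_inc)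
  then have D3: "dim D = 3" using P by simp
  have "dim D' \<le> card D'" using S by (intro dim_le_card') (simp add: D'_def)
  also have "\<dots> \<le> 2" using card_image_le[OF S(2), of "\<lambda>x. x - u"] S(3) by (simp add: D'_def)
  finally have "dim D' \<noteq> dim D" using D3 by simp
  moreover have "span D' \<subseteq> span D" by (intro span_mono) (use S in \<open>auto simp: D_def D'_def\<close>)
  ultimately have "span D' \<subset> span D" by (metis dim_span psubsetI)
  \<comment> \<open>Choosing \<open>c\<close> inside \<open>span D\<close> ensures that it is not
    constant on \<open>P\<close>; otherwise it would be orthogonal to itself.\<close>
  then obtain c where c: "c \<noteq> 0" "c \<in> span D" "\<And>y. y \<in> span D' \<Longrightarrow> orthogonal c y"
    using orthogonal_to_subspace_exists_gen by metis
  have cS: "c \<bullet> s = c \<bullet> u" if "s \<in> S" for s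
    using c(3)[of "s - u"] that by (auto simp: D'_def orthogonal_def inner_diff_right intro: span_base)
  have "\<exists>x\<in>P. c \<bullet> x \<noteq> c \<bullet> u"
  proof (rule ccontr)
    assume "\<not> ?thesis"
    then have "\<And>y. y \<in> D \<Longrightarrow> orthogonal c y" by (auto simp: D_def orthogonal_def inner_diff_right)
    then have "orthogonal c c" using c(2) orthogonal_to_span by blast
    then show False using c(1) by (simp add: orthogonal_def)
  qed
  then obtain x where x: "x \<in> P" "c \<bullet> x \<noteq> c \<bullet> u" by blast
  have up: "(u, v) \<in> (Restr (polytope_edges P) (- S))\<^sup>*" if "p \<in> P" "c \<bullet> u < c \<bullet> p" "c \<bullet> u \<le> c \<bullet> v" for p
    by (rule upper_vertices_connected[OF P(1) that(1,2) cS u _ v that(3)]) auto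
  have down: "(u, v) \<in> (Restr (polytope_edges P) (- S))\<^sup>*" if "p \<in> P" "c \<bullet> p < c \<bullet> u" "c \<bullet> v \<le> c \<bullet> u" for p
    by (rule upper_vertices_connected[OF P(1) that(1), of "- (c \<bullet> u)" "- c"]) (use that cS u v in auto)
  have "v \<in> P" using v polytope_vertices_subset by blast
  \<comment> \<open>If \<open>v\<close> is off the hyperplane, it serves itself as the point
    \<open>p\<close> on its side; if it is on the hyperplane, the side of \<open>x\<close> is
    used.\<close>
  then show ?thesis using up[of x] down[of x] up[of v] down[of v] x by linarith
qed

section \<open>Integer level functions on the graph\<close>

text \<open>Integer rather than natural values make the class closed under negation, which exchanges
  initial and final ranges.\<close>

definition edge_Lipschitz :: "'a::euclidean_space set \<Rightarrow> ('a \<Rightarrow> int) \<Rightarrow> bool" where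
  "edge_Lipschitz P f \<longleftrightarrow> (\<forall>(u, v) \<in> polytope_edges P. \<bar>f u - f v\<bar> \<le> 1)"

lemma edge_Lipschitz_face: "edge_Lipschitz P f \<Longrightarrow> F face_of P \<Longrightarrow> edge_Lipschitz F f"
  using polytope_edges_face unfolding edge_Lipschitz_def by blast

text \<open>Steps of size at most 1 cannot jump over the level \<open>l\<close>.\<close>

lemma path_avoiding_level:
  assumes "edge_Lipschitz P f" "(u, v) \<in> (Restr (polytope_edges P) (- S))\<^sup>*" "f u < l"
    and "\<And>w. w \<in> polytope_vertices P \<Longrightarrow> f w = l \<Longrightarrow> w \<in> S"
  shows "f v < l"
  using assms(2,3)
proof (induction rule: rtrancl_induct)
  case (step y z)
  then have "\<bar>f y - f z\<bar> \<le> 1" "z \<in> polytope_vertices P"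
    using assms(1) polytope_edges_vertices by (fastforce simp: edge_Lipschitz_def)+
  moreover have "f z \<noteq> l" using assms(4)[of z] step calculation(2) by blast
  ultimately show ?case using step by auto
qed simp

text \<open>A discrete intermediate value theorem: a missed level would separate the connected
  graph.\<close>

lemma level_attained:
  assumes "polytope P" "edge_Lipschitz P f" "u \<in> polytope_vertices P" "v \<in> polytope_vertices P"
    "f u \<le> l" "l \<le> f v"
  shows "\<exists>w \<in> polytope_vertices P. f w = l"
proof (rule ccontr)
  assume neg: "\<not> ?thesis"
  have "(u, v) \<in> (Restr (polytope_edges P) (- {}))\<^sup>*" using polytope_graph_connected assms by simp
  moreover have "f u < l" using neg assms(3,5) by force
  ultimately have "f v < l" by (rule path_avoiding_level[OF assms(2)]) (use neg in blast)
  then show False using assms by simp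
qed

lemma card_level_ge_3:
  assumes P: "polytope P" "aff_dim P = 3" and f: "edge_Lipschitz P f"
    and u: "u \<in> polytope_vertices P" "f u < l" and v: "v \<in> polytope_vertices P" "l < f v"
  shows "3 \<le> card {w \<in> polytope_vertices P. f w = l}" (is "3 \<le> card ?S")
proof (rule ccontr)
  assume "\<not> 3 \<le> card ?S"
  then have S: "?S \<subseteq> P" "finite ?S" "card ?S \<le> 2"
    using polytope_vertices_subset[of P] finite_polytope_vertices[OF P(1)] by auto
  have "(u, v) \<in> (Restr (polytope_edges P) (- ?S))\<^sup>*"
    by (rule connected_after_removing_two[OF P S]) (use u v in auto)
  then have "f v < l" by (rule path_avoiding_level[OF f _ u(2)]) auto
  then show False using v by simp
qed

lemma level_range_le_dim3:
  assumes P: "polytope P" "aff_dim P = 3" and f: "edge_Lipschitz P f"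
    and u: "u \<in> polytope_vertices P" and v: "v \<in> polytope_vertices P" and less: "f u < f v"
  shows "3 * (f v - f u) + 3 \<le>
    2 * int (card (facets_meeting P {w \<in> polytope_vertices P. f u \<le> f w \<and> f w \<le> f v}))"
proof -
  let ?W = "{w \<in> polytope_vertices P. f u \<le> f w \<and> f w \<le> f v}"
  let ?A = "\<lambda>l. {w \<in> polytope_vertices P. f w = l}"
  have fin: "finite (polytope_vertices P)" using finite_polytope_vertices P by blast
  have "?W = (\<Union>l\<in>{f u..f v}. ?A l)" by auto
  then have "card ?W = (\<Sum>l\<in>{f u..f v}. card (?A l))"
    using fin by (simp only:, intro card_UN_disjoint) auto
  moreover have "{f u..f v} = insert (f u) (insert (f v) {f u + 1..f v - 1})" using less by auto
  ultimately have "card ?W = card (?A (f u)) + (card (?A (f v)) + (\<Sum>l\<in>{f u + 1..f v - 1}. card (?A l)))"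
    using less by simp
  moreover have "card (?A (f u)) \<noteq> 0" "card (?A (f v)) \<noteq> 0" using fin u v by auto
  moreover have "(\<Sum>l\<in>{f u + 1..f v - 1}. card (?A l)) \<ge> (\<Sum>l\<in>{f u + 1..f v - 1}. 3)"
    by (rule sum_mono) (use card_level_ge_3[OF P f u _ v] in auto)
  moreover have "card ?W + 4 \<le> 2 * card (facets_meeting P ?W)"
    by (rule card_vertices_le_facets_meeting[OF P]) (use u less in auto)
  ultimately show ?thesis using less by simp
qed

section \<open>The numerical recursion\<close>

lemma powr_log_swap:
  fixes x y :: real
  assumes "0 < x" "0 < y"
  shows "x powr log 2 y = y powr log 2 x"
  using assms by (simp add: powr_def log_def)

text \<open>The case D = 3, where the facet term is x itself. The least argument 11/3 is 2/3 (8 - 4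
  + 3/2). Near it only the exponents k <= 1 would be available in the general estimate below, and
  these are too weak, so the difference of the two sides is shown to be nonnegative at 11/3 and
  nondecreasing.\<close>

lemma halving_recursion_dim4:
  fixes x :: real
  assumes "11 / 3 \<le> x"
  shows "x + 2 * (x / 2 - 5 / 6) powr log 2 3 + 2 \<le> x powr log 2 3"
proof -
  define a :: real where "a = log 2 3"
  \<comment> \<open>The rational bound 11/7 for log 2 3 rests on 2^11 = 2048 <= 2187 = 3^7.\<close>
  have "11 = log 2 (2 powr 11 :: real)" by (subst log_powr_cancel) auto
  also have "\<dots> \<le> log 2 (3 powr 7)" by (subst log_le_cancel_iff) auto
  also have "\<dots> = 7 * a" unfolding a_def by (rule log_powr)
  finally have a: "11 / 7 \<le> a" by simp
  have half: "2 powr (a - 1) = 3 / 2" by (simp add: a_def powr_diff)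
  define h where "h y = y powr a - 2 * (y / 2 - 5 / 6) powr a - y - 2" for y :: real
  have "h (11 / 3) \<le> h x"
  proof (rule DERIV_nonneg_imp_nondecreasing[OF assms])
    fix y :: real assume y: "11 / 3 \<le> y" "y \<le> x"
    define z where "z = y / 2 - 5 / 6"
    have z: "0 < z" "z \<le> y / 2" "0 < y" using y by (auto simp: z_def)
    have "(h has_real_derivative (a * y powr (a - 1) - 2 * (a * z powr (a - 1) * (1 / 2)) - 1)) (at y)"
      unfolding h_def using z by (auto intro!: derivative_eq_intros simp: z_def)
    \<comment> \<open>7/11 is the reciprocal of the lower bound for \<open>a\<close>. The difference
      is at least t / 2, and t >= sqrt (11/6) >= 14/11 since y / 2 >= 11/6 and a - 1 >= 1/2.\<close>
    moreover have "7 / 11 \<le> y powr (a - 1) - z powr (a - 1)"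
    proof -
      define t where "t = (y / 2) powr (a - 1)"
      have y_eq: "y powr (a - 1) = 3 / 2 * t"
        unfolding t_def half[symmetric] using z by (subst powr_mult[symmetric]) auto
      have zt: "z powr (a - 1) \<le> t" unfolding t_def using z a by (intro powr_mono2) auto
      have "14 / 11 \<le> sqrt (11 / 6 :: real)" by (rule real_le_rsqrt) (simp add: power2_eq_square)
      also have "\<dots> = (11 / 6) powr (1 / 2)" by (simp add: powr_half_sqrt)
      also have "\<dots> \<le> (11 / 6) powr (a - 1)" using a by (intro powr_mono) auto
      also have "\<dots> \<le> t" unfolding t_def using y a by (intro powr_mono2) auto
      finally show ?thesis using y_eq zt by linarith
    qed
    then have "11 / 7 * (7 / 11) \<le> a * (y powr (a - 1) - z powr (a - 1))"
      using a by (intro mult_mono) auto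
    then have "0 \<le> a * y powr (a - 1) - 2 * (a * z powr (a - 1) * (1 / 2)) - 1"
      by (simp add: algebra_simps)
    ultimately show "\<exists>D. (h has_real_derivative D) (at y) \<and> 0 \<le> D" by blast
  qed
  moreover have "0 \<le> h (11 / 3)"
  proof -
    \<comment> \<open>At 11/3 the halved argument is exactly 1, so the claim there is 2 + 11/3 + 2 =
      23/3 <= (11/3) powr a.\<close>
    have pow: "(23 / 3 :: real) ^ 7 \<le> (11 / 3) ^ 11" by (simp add: power_divide)
    have "23 / 3 = ((23 / 3 :: real) powr 7) powr (1 / 7)" by (simp only: powr_powr) simp
    also have "\<dots> \<le> ((11 / 3) powr 11) powr (1 / 7)"
      by (intro powr_mono2) (use pow in auto)
    also have "\<dots> = (11 / 3 :: real) powr (11 / 7)" by (simp only: powr_powr) simp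
    also have "\<dots> \<le> (11 / 3) powr a" using a by (intro powr_mono) auto
    finally show ?thesis by (simp add: h_def)
  qed
  ultimately show ?thesis by (simp add: h_def a_def)
qed

text \<open>With \<open>Y = x powr log 2 D = D powr log 2 x\<close>, the left-hand side is at most
  \<open>Y ((1 - 1/D)^k + (2/D) q + 2/D^k)\<close> for every \<open>k \<le> log 2 x\<close>, where \<open>q\<close> bounds the
  \<open>log 2 D\<close>-th power of the ratio of the halved argument to \<open>x/2\<close>.\<close>

lemma halving_recursion_bound:
  fixes x D q :: real
  assumes D: "4 \<le> D" and x: "0 < x" "2 ^ k \<le> x" and z: "0 \<le> z" "(2 * z / x) powr log 2 D \<le> q"
    and le: "(D - 1) ^ k + 2 * q * D ^ k / D + 2 \<le> D ^ k"
  shows "x powr log 2 (D - 1) + 2 * z powr log 2 D + 2 \<le> x powr log 2 D"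
proof -
  define l where "l = log 2 x"
  define Y where "Y = D powr l"
  have l: "real k \<le> l" using x by (simp add: l_def le_log_iff powr_realpow)
  have Y: "x powr log 2 D = Y" unfolding Y_def l_def by (rule powr_log_swap) (use x D in auto)
  have "D ^ k = D powr real k" using D by (simp add: powr_realpow)
  also have "\<dots> \<le> Y" unfolding Y_def using l D by (intro powr_mono) auto
  finally have Yk: "D ^ k \<le> Y" .
  have Dk: "0 < D ^ k" using D by simp
  have "x powr log 2 (D - 1) = (D - 1) powr l"
    unfolding l_def by (rule powr_log_swap) (use x D in auto)
  also have "\<dots> = Y * ((D - 1) / D) powr l" unfolding Y_def using D by (simp add: powr_divide)
  also have "\<dots> \<le> Y * ((D - 1) / D) powr real k"
    using l D by (intro mult_left_mono powr_mono') (auto simp: Y_def)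
  also have "\<dots> = Y * ((D - 1) ^ k / D ^ k)" using D by (simp add: powr_realpow power_divide)
  finally have 1: "x powr log 2 (D - 1) \<le> Y * ((D - 1) ^ k / D ^ k)" .
  have "z powr log 2 D = (x / 2 * (2 * z / x)) powr log 2 D" using x by simp
  also have "\<dots> = (x / 2) powr log 2 D * (2 * z / x) powr log 2 D"
    by (rule powr_mult)
  also have "(x / 2) powr log 2 D = Y / D" using x D by (simp add: powr_divide Y)
  also have "Y / D * (2 * z / x) powr log 2 D \<le> Y / D * q"
    using z D by (intro mult_left_mono) (auto simp: Y_def)
  finally have 2: "z powr log 2 D \<le> Y / D * q" .
  have 3: "2 \<le> Y * (2 / D ^ k)" using Yk Dk by (simp add: field_simps)
  have "Y * ((D - 1) ^ k / D ^ k) + 2 * (Y / D * q) + Y * (2 / D ^ k)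
      = Y * (((D - 1) ^ k + 2 * q * D ^ k / D + 2) / D ^ k)"
    using D by (simp add: field_simps)
  also have "\<dots> \<le> Y * 1" using le Dk by (intro mult_left_mono) (auto simp: Y_def)
  finally show ?thesis using 1 2 3 unfolding Y by linarith
qed

text \<open>For x >= 8 the exponent k = 3 suffices even with the trivial ratio bound 1. For smaller
  x only k = 2 is available, and the shift (2 D - 1) / 6 must be exploited.\<close>

lemma halving_recursion:
  fixes x D :: real
  assumes D: "4 \<le> D" and x: "(2 * D + 5) / 3 \<le> x"
  shows "x powr log 2 (D - 1) + 2 * (x / 2 - (2 * D - 1) / 6) powr log 2 D + 2 \<le> x powr log 2 D"
proof -
  define z where "z = x / 2 - (2 * D - 1) / 6"
  have x4: "4 \<le> x" and z: "1 \<le> z" using x D by (auto simp: z_def field_simps)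
  have ratio: "2 * z / x = 1 - (2 * D - 1) / (3 * x)" using x4 by (simp add: z_def field_simps)
  have L: "2 \<le> log 2 D" using D by (simp add: le_log_iff)
  show ?thesis
  proof (cases "8 \<le> x")
    case True
    show ?thesis
      unfolding z_def[symmetric]
    proof (rule halving_recursion_bound[of D x 3 z 1])
      have "2 * z / x \<le> 1" unfolding ratio using D x4 by simp
      then show "(2 * z / x) powr log 2 D \<le> 1"
        using z x4 L by (intro powr_le1) auto
      have "3 * D + 1 \<le> D * D" using mult_right_mono[OF D, of D] D by linarith
      then show "(D - 1) ^ 3 + 2 * 1 * D ^ 3 / D + 2 \<le> D ^ 3"
        using D by (simp add: power3_eq_cube algebra_simps)
    qed (use D x4 z True in auto)
  next
    case False
    show ?thesis
      unfolding z_def[symmetric]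
    \<comment> \<open>Here 2 D - 1 >= 7 and 3 x <= 24 give the ratio at most 17/24; its square is
      289/576, and log 2 D >= 2.\<close>
    proof (rule halving_recursion_bound[of D x 2 z "289 / 576"])
      have "7 / 24 \<le> (2 * D - 1) / (3 * x)" using False D x4 by (intro frac_le) auto
      then have q: "2 * z / x \<le> 17 / 24" "0 < 2 * z / x" using ratio z x4 by linarith (use z x4 in simp)
      have "(2 * z / x) powr log 2 D \<le> (2 * z / x) powr 2"
        using q L by (intro powr_mono') auto
      also have "\<dots> \<le> (17 / 24) powr 2" using q by (intro powr_mono2) auto
      also have "\<dots> = 289 / 576" by (simp add: power2_eq_square)
      finally show "(2 * z / x) powr log 2 D \<le> 289 / 576" .
      show "(D - 1)\<^sup>2 + 2 * (289 / 576) * D\<^sup>2 / D + 2 \<le> D\<^sup>2"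
        using D by (simp add: power2_eq_square algebra_simps)
    qed (use D x4 z in auto)
  qed
qed

section \<open>The bound as a function of dimension and number of facets\<close>

definition diameter_bound :: "nat \<Rightarrow> nat \<Rightarrow> real" where
  "diameter_bound d n = (2 / 3 * (real n - real d + 3 / 2)) powr log 2 (real d - 1)"

lemma diameter_bound_nonneg: "0 \<le> diameter_bound d n"
  by (simp add: diameter_bound_def)

lemma diameter_bound_mono:
  assumes "2 \<le> d" "d \<le> m" "m \<le> n"
  shows "diameter_bound d m \<le> diameter_bound d n"
  unfolding diameter_bound_def using assms by (intro powr_mono2) auto

text \<open>Both sides have the same base, which is at least 2/3 * 3/2 = 1; only the exponent
  grows.\<close>

lemma diameter_bound_facet:
  assumes "3 \<le> d" "d \<le> n"
  shows "diameter_bound (d - 1) (n - 1) \<le> diameter_bound d n"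
proof -
  have "real (n - 1) - real (d - 1) = real n - real d" "real (d - 1) - 1 = real d - 2"
    using assms by (auto simp: of_nat_diff)
  then have "diameter_bound (d - 1) (n - 1) = (2 / 3 * (real n - real d + 3 / 2)) powr log 2 (real d - 2)"
    by (simp add: diameter_bound_def)
  also have "\<dots> \<le> diameter_bound d n"
    unfolding diameter_bound_def using assms by (intro powr_mono) auto
  finally show ?thesis .
qed

text \<open>\<open>\<beta>\<close> is the bound evaluated at the real number n / 2, which avoids
  rounding. The shift (2 D - 1) / 6 appears because d is not halved along with n, and n >= 2 d
  becomes x >= (2 D + 5) / 3.\<close>

lemma diameter_bound_halving:
  assumes d: "4 \<le> d" "2 * d \<le> n"
  obtains \<beta> where "0 \<le> \<beta>" "\<And>m. d \<le> m \<Longrightarrow> 2 * m \<le> n \<Longrightarrow> diameter_bound d m \<le> \<beta>"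
    "diameter_bound (d - 1) (n - 1) + 2 * \<beta> + 2 \<le> diameter_bound d n"
proof
  define x where "x = 2 / 3 * (real n - real d + 3 / 2)"
  define D where "D = real d - 1"
  define z where "z = x / 2 - (2 * D - 1) / 6"
  show "0 \<le> z powr log 2 D" by simp
  show "diameter_bound d m \<le> z powr log 2 D" if "d \<le> m" "2 * m \<le> n" for m
  proof -
    have "2 * real m \<le> real n" using that(2) by linarith
    then have "2 / 3 * (real m - real d + 3 / 2) \<le> z" by (simp add: z_def x_def D_def field_simps)
    then show ?thesis
      unfolding diameter_bound_def D_def using that d by (intro powr_mono2) auto
  qed
  have x: "(2 * D + 5) / 3 \<le> x" using d by (simp add: x_def D_def field_simps)
  have "x powr log 2 (D - 1) + 2 * z powr log 2 D + 2 \<le> x powr log 2 D"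
  proof (cases "d = 4")
    case True
    then have "D = 3" by (simp add: D_def)
    then show ?thesis using halving_recursion_dim4[of x] x by (simp add: z_def)
  next
    case False
    then have "4 \<le> D" using d by (simp add: D_def)
    then show ?thesis using halving_recursion[OF _ x] by (simp add: z_def)
  qed
  moreover have "diameter_bound (d - 1) (n - 1) = x powr log 2 (D - 1)"
    using d by (simp add: diameter_bound_def x_def D_def of_nat_diff)
  ultimately show "diameter_bound (d - 1) (n - 1) + 2 * z powr log 2 D + 2 \<le> diameter_bound d n"
    by (simp add: diameter_bound_def x_def D_def)
qed

section \<open>The recursion for level functions\<close>

definition facets_meeting_levels ::
  "'a::euclidean_space set \<Rightarrow> ('a \<Rightarrow> int) \<Rightarrow> int \<Rightarrow> int \<Rightarrow> 'a set set" where
  "facets_meeting_levels P f a b = facets_meeting P {w \<in> polytope_vertices P. a \<le> f w \<and> f w \<le> b}"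

lemma facets_meeting_levels_iff:
  "F \<in> facets_meeting_levels P f a b \<longleftrightarrow>
     F facet_of P \<and> (\<exists>w \<in> polytope_vertices P. w \<in> F \<and> a \<le> f w \<and> f w \<le> b)"
  unfolding facets_meeting_levels_def facets_meeting_def by blast

lemma finite_facets_meeting_levels: "polytope P \<Longrightarrow> finite (facets_meeting_levels P f a b)"
  by (simp add: facets_meeting_levels_def finite_facets_meeting)

lemma facets_meeting_levels_uminus:
  "facets_meeting_levels P (\<lambda>x. - f x) (- b) (- a) = facets_meeting_levels P f a b"
  by (auto simp: facets_meeting_levels_iff)

lemma edge_Lipschitz_uminus: "edge_Lipschitz P f \<Longrightarrow> edge_Lipschitz P (\<lambda>x. - f x)"
  unfolding edge_Lipschitz_def by fastforce

lemma dim_le_card_facets_meeting_levels: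
  assumes "polytope P" "aff_dim P = int d" "u \<in> polytope_vertices P" "a \<le> f u" "f u \<le> b"
  shows "d \<le> card (facets_meeting_levels P f a b)"
proof -
  have "{F. F facet_of P \<and> u \<in> F} \<subseteq> facets_meeting_levels P f a b"
    using assms by (auto simp: facets_meeting_levels_iff)
  then show ?thesis
    using card_facets_at_vertex[OF assms(1,3,2)] card_mono finite_facets_meeting_levels[OF assms(1)]
    by (meson order_trans)
qed

text \<open>The strict drop lets the induction below run on the number of facets met alone, although
  the dimension changes too.\<close>

lemma card_facets_meeting_levels_facet:
  assumes P: "polytope P" and F: "F \<in> facets_meeting_levels P f a b" and "a \<le> a'" "b' \<le> b"
  shows "card (facets_meeting_levels F f a' b') + 1 \<le> card (facets_meeting_levels P f a b)"
proof (rule card_facet_facets[OF P])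
  show FP: "F facet_of P" using F by (simp add: facets_meeting_levels_iff)
  show "R facet_of F" if "R \<in> facets_meeting_levels F f a' b'" for R
    using that by (simp add: facets_meeting_levels_iff)
  show "finite (facets_meeting_levels P f a b)" by (rule finite_facets_meeting_levels[OF P])
  show "F \<in> facets_meeting_levels P f a b" by (rule F)
  fix R G assume "R \<in> facets_meeting_levels F f a' b'" "G facet_of P" "R \<subseteq> G"
  then show "G \<in> facets_meeting_levels P f a b"
    using assms(3,4) polytope_vertices_face[OF facet_of_imp_face_of[OF FP]]
    unfolding facets_meeting_levels_iff by fastforce
qed

text \<open>The Kalai--Kleitman argument for arbitrary Lipschitz level functions instead of the distance
  from a vertex: this class of level functions is closed under restriction to faces and to
  subintervals, so no polyhedron with fewer facets, which might be unbounded, has to be introduced.\<close>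

lemma level_range_le_diameter_bound:
  assumes "3 \<le> d" "polytope P" "aff_dim P = int d" "edge_Lipschitz P f"
    and "u \<in> polytope_vertices P" "v \<in> polytope_vertices P" "f u \<le> f v"
  shows "of_int (f v - f u) \<le> diameter_bound d (card (facets_meeting_levels P f (f u) (f v)))"
  using assms
proof (induction "card (facets_meeting_levels P f (f u) (f v))" arbitrary: d P f u v rule: less_induct)
  case less
  note d = \<open>3 \<le> d\<close> and P = less.prems(2,3) and f = less.prems(4) and uv = less.prems(5-7)
  let ?T = "facets_meeting_levels P f (f u) (f v)"
  define m where "m = card ?T"
  have finT: "finite ?T" using finite_facets_meeting_levels P by blast
  have dm: "d \<le> m"
    unfolding m_def using dim_le_card_facets_meeting_levels[OF P uv(1)] uv by blast
  consider "f u = f v" | "f u < f v" "d = 3" | "f u < f v" "4 \<le> d" using uv d by linarith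
  then have "of_int (f v - f u) \<le> diameter_bound d m"
  proof cases
    case 1
    then show ?thesis using diameter_bound_nonneg by simp
  next
    case 2
    have "3 * (f v - f u) + 3 \<le> 2 * int m"
      unfolding m_def facets_meeting_levels_def
      using level_range_le_dim3[OF P(1) _ f uv(1,2) 2(1)] P(2) 2(2) by simp
    then have "3 * real_of_int (f v - f u) + 3 \<le> 2 * real m" by linarith
    then show ?thesis using 2(2) dm by (simp add: diameter_bound_def field_simps)
  next
    case 3
    note d4 = 3(2)
    \<comment> \<open>The induction hypothesis in dimension d - 1, made uniform by monotonicity: at
      most m - 1 facets of \<open>F\<close> meet the range.\<close>
    have in_facet: "of_int (f y - f x) \<le> diameter_bound (d - 1) (m - 1)"
      if F: "F \<in> ?T" and xy: "x \<in> polytope_vertices F" "y \<in> polytope_vertices F"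
        "f u \<le> f x" "f x \<le> f y" "f y \<le> f v" for F x y
    proof -
      have FP: "F facet_of P" "F face_of P"
        using F facet_of_imp_face_of by (auto simp: facets_meeting_levels_iff)
      have F': "polytope F" "aff_dim F = int (d - 1)" "edge_Lipschitz F f"
        using facet_polytope[OF P(1) FP(1)] edge_Lipschitz_face[OF f FP(2)] FP(1) P(2) d
        by (auto simp: facet_of_def of_nat_diff)
      let ?k = "card (facets_meeting_levels F f (f x) (f y))"
      have k: "?k + 1 \<le> m"
        unfolding m_def by (rule card_facets_meeting_levels_facet[OF P(1) F xy(3,5)])
      have "of_int (f y - f x) \<le> diameter_bound (d - 1) ?k"
        by (rule less.hyps) (use k m_def d4 F' xy in auto)
      also have "\<dots> \<le> diameter_bound (d - 1) (m - 1)"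
        using dim_le_card_facets_meeting_levels[OF F'(1,2) xy(1), of "f x" f "f y"] xy k d4
        by (intro diameter_bound_mono) auto
      finally show ?thesis .
    qed
    show ?thesis
    proof (cases "m < 2 * d")
      case True
      define X where "X w = {F. F facet_of P \<and> w \<in> F}" for w
      have sub: "X u \<subseteq> ?T" "X v \<subseteq> ?T" using uv by (auto simp: X_def facets_meeting_levels_iff)
      have "X u \<inter> X v \<noteq> {}"
      proof
        assume "X u \<inter> X v = {}"
        then have "card (X u \<union> X v) = card (X u) + card (X v)"
          using sub finT finite_subset by (intro card_Un_disjoint) blast+
        moreover have "card (X u \<union> X v) \<le> m" unfolding m_def using sub finT by (intro card_mono) auto
        moreover have "d \<le> card (X u)" "d \<le> card (X v)"
          unfolding X_def using card_facets_at_vertex[OF P(1) _ P(2)] uv by blast+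
        ultimately show False using True by linarith
      qed
      then obtain F where F: "F \<in> X u" "F \<in> X v" by blast
      then have "u \<in> polytope_vertices F" "v \<in> polytope_vertices F"
        using polytope_vertices_face[of F P] facet_of_imp_face_of[of F P] uv by (auto simp: X_def)
      then have "of_int (f v - f u) \<le> diameter_bound (d - 1) (m - 1)"
        using in_facet[of F u v] F sub uv by blast
      then show ?thesis using diameter_bound_facet[OF d dm] by linarith
    next
      case False
      then obtain \<beta> where \<beta>: "0 \<le> \<beta>" "\<And>k. d \<le> k \<Longrightarrow> 2 * k \<le> m \<Longrightarrow> diameter_bound d k \<le> \<beta>"
        "diameter_bound (d - 1) (m - 1) + 2 * \<beta> + 2 \<le> diameter_bound d m"
        using diameter_bound_halving[OF d4, of m] by force
      \<comment> \<open>\<open>p\<close> is the first level at which more than half of the facets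
        are met. The range up to p - 1 falls under the induction hypothesis, and the last step adds
        1.\<close>
      have half: "\<exists>p. g s \<le> p \<and> p \<le> g t \<and> m < 2 * card (facets_meeting_levels P g (g s) p) \<and>
          of_int (p - g s) \<le> 1 + \<beta>"
        if g: "edge_Lipschitz P g" and st: "s \<in> polytope_vertices P" "t \<in> polytope_vertices P" "g s \<le> g t"
          and m: "card (facets_meeting_levels P g (g s) (g t)) = m" for g s t
      proof -
        let ?c = "\<lambda>a. card (facets_meeting_levels P g (g s) a)"
        define A where "A = {a \<in> {g s - 1..g t}. 2 * ?c a \<le> m}"
        have "facets_meeting_levels P g (g s) (g s - 1) = {}" by (auto simp: facets_meeting_levels_iff)
        \<comment> \<open>The empty range below \<open>g s\<close> meets no facet, so
          \<open>A\<close> is nonempty even if the level of \<open>s\<close> alone meets more than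
          half.\<close>
        then have A0: "g s - 1 \<in> A" using st by (simp add: A_def)
        have finA: "finite A" by (rule finite_subset[of _ "{g s - 1..g t}"]) (auto simp: A_def)
        define p where "p = Max A + 1"
        have pA: "p - 1 \<in> A" using Max_in[OF finA] A0 by (auto simp: p_def)
        have "g t \<notin> A" using m dm d by (simp add: A_def)
        then have range: "g s \<le> p" "p \<le> g t" using pA by (auto simp: A_def order_le_less)
        have "p \<notin> A" using Max_ge[OF finA, of p] by (auto simp: p_def)
        then have "m < 2 * ?c p" using range by (auto simp: A_def)
        moreover have "of_int (p - g s) \<le> 1 + \<beta>"
        proof (cases "p = g s")
          case True
          then show ?thesis using \<beta>(1) by simp
        next
          case False
          then obtain w where w: "w \<in> polytope_vertices P" "g w = p - 1"
            using level_attained[OF P(1) g st(1,2), of "p - 1"] range by auto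
          have k: "2 * ?c (g w) \<le> m" using pA w by (simp add: A_def)
          then have "?c (g w) < card ?T" using dm d unfolding m_def by linarith
          then have "of_int (g w - g s) \<le> diameter_bound d (?c (g w))"
            by (rule less.hyps) (use d P g st w range False in auto)
          also have "\<dots> \<le> \<beta>"
            using \<beta>(2)[OF dim_le_card_facets_meeting_levels[OF P st(1)] k] w range False by auto
          finally show ?thesis using w by simp
        qed
        ultimately show ?thesis using range by blast
      qed
      obtain p where p: "f u \<le> p" "p \<le> f v" "m < 2 * card (facets_meeting_levels P f (f u) p)"
        "of_int (p - f u) \<le> 1 + \<beta>"
        using half[OF f uv] m_def by blast
      obtain q where q: "f u \<le> q" "q \<le> f v" "m < 2 * card (facets_meeting_levels P f q (f v))"
        "of_int (f v - q) \<le> 1 + \<beta>"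
      \<comment> \<open>The final range of \<open>f\<close> is the initial range of -f.\<close>
      proof -
        have "\<exists>p. - f v \<le> p \<and> p \<le> - f u \<and>
            m < 2 * card (facets_meeting_levels P (\<lambda>x. - f x) (- f v) p) \<and> of_int (p - (- f v)) \<le> 1 + \<beta>"
          by (rule half[OF edge_Lipschitz_uminus[OF f] uv(2,1)])
            (use uv in \<open>auto simp: facets_meeting_levels_uminus m_def\<close>)
        then obtain p where "- f v \<le> p" "p \<le> - f u"
          "m < 2 * card (facets_meeting_levels P (\<lambda>x. - f x) (- f v) p)" "of_int (p - (- f v)) \<le> 1 + \<beta>"
          by blast
        then show ?thesis
          using that[of "- p"] facets_meeting_levels_uminus[of P f "f v" "- p"] by (simp add: add.commute)
      qed
      let ?U = "facets_meeting_levels P f (f u) p" and ?V = "facets_meeting_levels P f q (f v)"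
      have sub: "?U \<subseteq> ?T" "?V \<subseteq> ?T"
        using p q by (force simp: facets_meeting_levels_iff)+
      have "?U \<inter> ?V \<noteq> {}"
      proof
        assume "?U \<inter> ?V = {}"
        then have "card (?U \<union> ?V) = card ?U + card ?V"
          using sub finT finite_subset by (intro card_Un_disjoint) blast+
        moreover have "card (?U \<union> ?V) \<le> m" unfolding m_def using sub finT by (intro card_mono) auto
        ultimately show False using p q by linarith
      qed
      then obtain F where F: "F \<in> ?U" "F \<in> ?V" by blast
      then have FT: "F \<in> ?T" using sub by blast
      have FP: "F facet_of P" "F face_of P"
        using F facet_of_imp_face_of by (auto simp: facets_meeting_levels_iff)
      \<comment> \<open>Overlapping ranges leave no gap. Otherwise \<open>F\<close> has vertices at
        or below level \<open>p\<close> and at or above level \<open>q\<close>, hence vertices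
        exactly on both levels, and the bound inside a facet applies between them.\<close>
      have "of_int (q - p) \<le> diameter_bound (d - 1) (m - 1)"
      proof (cases "q \<le> p")
        case True
        then have "of_int (q - p) \<le> (0::real)" by simp
        then show ?thesis using diameter_bound_nonneg order_trans by blast
      next
        case False
        obtain s t where st: "s \<in> polytope_vertices F" "t \<in> polytope_vertices F" "f s \<le> p" "q \<le> f t"
          using F unfolding facets_meeting_levels_iff polytope_vertices_face[OF FP(2)] by blast
        have F': "polytope F" "edge_Lipschitz F f"
          using facet_polytope[OF P(1) FP(1)] edge_Lipschitz_face[OF f FP(2)] by auto
        obtain x where x: "x \<in> polytope_vertices F" "f x = p"
          using level_attained[OF F' st(1,2), of p] st False by auto
        obtain y where y: "y \<in> polytope_vertices F" "f y = q"
          using level_attained[OF F' st(1,2), of q] st False by auto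
        show ?thesis using in_facet[OF FT x(1) y(1)] x y p q False by simp
      qed
      then have "of_int (f v - f u) \<le> diameter_bound (d - 1) (m - 1) + 2 * \<beta> + 2"
        using p(4) q(4) by simp
      then show ?thesis using \<beta>(3) by linarith
    qed
  qed
  then show ?case by (simp add: m_def)
qed

section \<open>From level functions to distances and the diameter\<close>

lemma graph_dist_eq_Least:
  assumes "(u, v) \<in> E\<^sup>*"
  shows "graph_dist E u v = enat (LEAST k. (u, v) \<in> E ^^ k)"
proof -
  obtain n where "(u, v) \<in> E ^^ n" using assms rtrancl_imp_relpow by blast
  then have "(u, v) \<in> E ^^ (LEAST k. (u, v) \<in> E ^^ k)" by (rule LeastI)
  then show ?thesis
    unfolding graph_dist_def by (intro antisym INF_lower INF_greatest) (auto intro: Least_le)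
qed

text \<open>The distance from \<open>u\<close> is a level function: it changes by at most 1 along an
  edge, since edges can be traversed both ways.\<close>

lemma graph_dist_le_diameter_bound:
  fixes P :: "'a::euclidean_space set"
  assumes d: "3 \<le> d" "d < n" and P: "polytope P" "aff_dim P = int d" "card {F. F facet_of P} = n"
    and uv: "u \<in> polytope_vertices P" "v \<in> polytope_vertices P"
  shows "\<exists>k. graph_dist (polytope_edges P) u v = enat k \<and> real k \<le> diameter_bound d n"
proof -
  let ?E = "polytope_edges P"
  define l where "l w = (LEAST k. (u, w) \<in> ?E ^^ k)" for w
  have path: "(u, w) \<in> ?E ^^ l w" if w: "w \<in> polytope_vertices P" for w
  proof -
    obtain k where "(u, w) \<in> ?E ^^ k"
      using polytope_graph_connected[OF P(1) uv(1) w] rtrancl_imp_relpow by blast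
    then show ?thesis unfolding l_def by (rule LeastI)
  qed
  have step: "l y \<le> Suc (l x)" if xy: "(x, y) \<in> ?E" for x y
  proof -
    have "(u, y) \<in> ?E ^^ Suc (l x)"
      using path[of x] xy polytope_edges_vertices[OF xy] by auto
    then show ?thesis unfolding l_def by (rule Least_le)
  qed
  have Lip: "edge_Lipschitz P (\<lambda>w. int (l w))"
    unfolding edge_Lipschitz_def
  proof (intro ballI, clarify)
    fix x y assume "(x, y) \<in> ?E"
    then show "\<bar>int (l x) - int (l y)\<bar> \<le> 1" using step[of x y] step[of y x] polytope_edges_sym by force
  qed
  have lu: "l u = 0" unfolding l_def by (rule Least_eq_0) simp
  let ?T = "facets_meeting_levels P (\<lambda>w. int (l w)) (int (l u)) (int (l v))"
  have "real_of_int (int (l v) - int (l u)) \<le> diameter_bound d (card ?T)"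
    by (rule level_range_le_diameter_bound[OF d(1) P(1,2) Lip uv]) (simp add: lu)
  also have "\<dots> \<le> diameter_bound d n"
  proof (rule diameter_bound_mono)
    show "2 \<le> d" using d by simp
    show "d \<le> card ?T"
      by (rule dim_le_card_facets_meeting_levels[OF P(1,2) uv(1)]) (auto simp: lu)
    show "card ?T \<le> n"
      unfolding P(3)[symmetric]
      by (rule card_mono[OF finite_polytope_facets[OF P(1)]]) (auto simp: facets_meeting_levels_iff)
  qed
  finally have "real (l v) \<le> diameter_bound d n" by (simp add: lu)
  moreover have "graph_dist ?E u v = enat (l v)"
    unfolding l_def by (rule graph_dist_eq_Least[OF polytope_graph_connected[OF P(1) uv]])
  ultimately show ?thesis by blast
qed

theorem theorem4p1:
  fixes d n :: nat
  assumes "3 \<le> d" and "d < n"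
  shows "ereal_of_enat (Delta_b TYPE('a::euclidean_space) d n)
           \<le> ereal ((2 / 3 * (real n - real d + 3 / 2)) powr log 2 (real d - 1))"
proof -
  \<comment> \<open>Distances are natural numbers, so rounding the real bound down loses nothing and
    gives a bound for the supremum within \<open>enat\<close>.\<close>
  define N where "N = nat \<lfloor>diameter_bound d n\<rfloor>"
  have "Delta_b TYPE('a) d n \<le> enat N"
    unfolding Delta_b_def polytope_diameter_def
  proof (intro SUP_least)
    fix P :: "'a set" and u v
    assume P: "P \<in> {P. polytope P \<and> aff_dim P = int d \<and> card {F. F facet_of P} = n}"
      and uv: "u \<in> polytope_vertices P" "v \<in> polytope_vertices P"
    then obtain k where "graph_dist (polytope_edges P) u v = enat k" "real k \<le> diameter_bound d n"
      using graph_dist_le_diameter_bound[OF assms, of P u v] by blast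
    then show "graph_dist (polytope_edges P) u v \<le> enat N" by (simp add: N_def le_nat_floor)
  qed
  then have "ereal_of_enat (Delta_b TYPE('a) d n) \<le> ereal_of_enat (enat N)"
    by (simp only: ereal_of_enat_le_iff)
  also have "\<dots> = ereal (real N)" by simp
  also have "\<dots> \<le> ereal (diameter_bound d n)"
    using of_nat_floor[OF diameter_bound_nonneg] by (simp add: N_def)
  finally show ?thesis unfolding diameter_bound_def .
qed

end
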